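(* Let $D$ be a complete discrete valuation ring (possibly noncommutative; see context) with division ring of quotients $F$ and $J(D)$-adic filtration $v_F$ on $F$. Let $n\ge1$, let $Q$ be a simple artinian ring with a ring isomorphism $\iota:Q\to M_n(F)$, give $Q$ the filtration $v_Q=M_n(v_F)\circ\iota$, and put $\mathcal{O}=\iota^{-1}(M_n(D))$. Let $(\sigma,\delta)$ be a skew derivation on $Q$ compatible with $v_Q$. Then $\mathcal{O}[[x;\sigma,\delta]]$ has no nonzero $\mathcal{O}[x;\sigma,\delta]$-disjoint ideals; that is, every nonzero two-sided ideal $I$ of $\mathcal{O}[[x;\sigma,\delta]]$ satisfies $I\cap\mathcal{O}[x;\sigma,\delta]\ne0$. Consequently, if the skew polynomial ring $Q[x;\sigma,\delta]$ is a simple ring, then $Q\otimes_{\mathcal{O}}\mathcal{O}[[x;\sigma,\delta]]$ is a simple ring.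
   Context: A filtration on a ring $R$ is a function $f:R\to\mathbb{Z}\cup\{\infty\}$ with $f(1)=0$, $f(r+s)\ge\min\{f(r),f(s)\}$, $f(rs)\ge f(r)+f(s)$, and $f(r)=\infty$ iff $r=0$; it is positive if its values lie in $\mathbb{N}\cup\{\infty\}$. The matrix filtration $M_n(f)$ on $M_n(A)$ sends a matrix to the minimum of the $f$-values of its entries. A discrete valuation ring is a (two-sided) noetherian domain $D$, not necessarily commutative, such that for every nonzero $z$ in its division ring of quotients $Q(D)$, either $z\in D$ or $z^{-1}\in D$. Then $J(D)=\pi D=D\pi$ for some normal element $\pi$ (a uniformiser), and the $J(D)$-adic filtration on $F=Q(D)$ is $v_F(z)=\sup\{k: z\in\pi^kD\}$ (so $v_F(z)=0$ for all $z\neq 0$ if $J(D)=0$). $D$ is complete if it is complete for this filtration. A skew derivation $(\sigma,\delta)$ on a ring $R$ consists of an automorphism $\sigma$ and an additive map $\delta:R\to R$ with $\delta(rs)=\delta(r)s+\sigma(r)\delta(s)$. It is compatible with a filtration $v$ if $v(\sigma(r))=v(r)$ and $v(\delta(r))>v(r)$ for all $0\ne r\in R$. In the setting of the claim, $(\sigma,\delta)$ restricts to a compatible skew derivation on $\mathcal{O}$ (with filtration $v_Q|_{\mathcal{O}}$). $R[x;\sigma,\delta]$ is the skew polynomial ring: $R[x]$ as a left $R$-module, with multiplication determined by $xr=\sigma(r)x+\delta(r)$. If $(R,v)$ is complete and positively filtered and $(\sigma,\delta)$ is compatible, $R[[x;\sigma,\delta]]$ is the set of formal series $\sum_{i\ge0}r_ix^i$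 with the (well-defined, continuous, associative) multiplication determined by the same rule; it contains $R[x;\sigma,\delta]$. For rings $R\subseteq S$, an ideal $I$ of $S$ is $R$-disjoint if $I\cap R=0$. The ring structure on $Q\otimes_{\mathcal{O}}\mathcal{O}[[x;\sigma,\delta]]$ is that of the localisation of $\mathcal{O}[[x;\sigma,\delta]]$ at the powers of the normal regular element $\iota^{-1}(\pi I)$, under which $Q$ is the corresponding localisation of $\mathcal{O}$ (if $J(D)=0$ then $Q=\mathcal{O}$ and the ring is just $\mathcal{O}[[x;\sigma,\delta]]$). *)

theory Defs
  imports
    "HOL-Library.Extended_Real"
    "HOL-Algebra.Ideal"
    "HOL-Algebra.Subrings"
    "HOL-Algebra.QuotRing"
    "HOL-Algebra.Algebraic_Closure_Type"
    "HOL-Algebra.Free_Abelian_Groups"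
    "HOL-Analysis.Finite_Cartesian_Product"
begin

text \<open>
  The division ring \<open>F\<close> and the ring \<open>Q\<close> are types of class \<^class>\<open>division_ring\<close> and
  \<^class>\<open>ring_1\<close>; multiplication is not assumed commutative in either class. When such a ring is
  treated as an object of \<open>HOL-Algebra\<close>, it is \<^const>\<open>ring_of_type_algebra\<close>.
\<close>

abbreviation subring_of_type :: "'a::ring_1 set \<Rightarrow> 'a ring"
  where "subring_of_type A \<equiv> ring_of_type_algebra \<lparr>carrier := A\<rparr>"


subsection \<open>Noncommutative ring theory\<close>

text \<open>The locale \<^locale>\<open>ideal\<close> is two-sided, but \<open>HOL-Algebra\<close> has no one-sided ideals.\<close>

definition left_ideal :: "'a set \<Rightarrow> ('a, 'm) ring_scheme \<Rightarrow> bool"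
  where "left_ideal I R \<longleftrightarrow>
    ring R \<and> additive_subgroup I R \<and> (\<forall>a\<in>I. \<forall>r\<in>carrier R. r \<otimes>\<^bsub>R\<^esub> a \<in> I)"

definition right_ideal :: "'a set \<Rightarrow> ('a, 'm) ring_scheme \<Rightarrow> bool"
  where "right_ideal I R \<longleftrightarrow>
    ring R \<and> additive_subgroup I R \<and> (\<forall>a\<in>I. \<forall>r\<in>carrier R. a \<otimes>\<^bsub>R\<^esub> r \<in> I)"

definition acc_on :: "('a set \<Rightarrow> bool) \<Rightarrow> bool"
  where "acc_on P \<longleftrightarrow>
    (\<forall>C::nat \<Rightarrow> 'a set. (\<forall>k. P (C k)) \<and> incseq C \<longrightarrow> (\<exists>N. \<forall>k\<ge>N. C k = C N))"

definition dcc_on :: "('a set \<Rightarrow> bool) \<Rightarrow> bool"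
  where "dcc_on P \<longleftrightarrow>
    (\<forall>C::nat \<Rightarrow> 'a set. (\<forall>k. P (C k)) \<and> decseq C \<longrightarrow> (\<exists>N. \<forall>k\<ge>N. C k = C N))"

definition two_sided_noetherian :: "('a, 'm) ring_scheme \<Rightarrow> bool"
  where "two_sided_noetherian R \<longleftrightarrow>
    ring R \<and> acc_on (\<lambda>I. left_ideal I R) \<and> acc_on (\<lambda>I. right_ideal I R)"

definition two_sided_artinian :: "('a, 'm) ring_scheme \<Rightarrow> bool"
  where "two_sided_artinian R \<longleftrightarrow>
    ring R \<and> dcc_on (\<lambda>I. left_ideal I R) \<and> dcc_on (\<lambda>I. right_ideal I R)"

definition simple_ring :: "('a, 'm) ring_scheme \<Rightarrow> bool"
  where "simple_ring R \<longleftrightarrow>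
    ring R \<and> \<one>\<^bsub>R\<^esub> \<noteq> \<zero>\<^bsub>R\<^esub> \<and> (\<forall>I. ideal I R \<longrightarrow> I = {\<zero>\<^bsub>R\<^esub>} \<or> I = carrier R)"

definition maximal_left_ideal :: "'a set \<Rightarrow> ('a, 'm) ring_scheme \<Rightarrow> bool"
  where "maximal_left_ideal M R \<longleftrightarrow>
    left_ideal M R \<and> M \<noteq> carrier R \<and>
    (\<forall>I. left_ideal I R \<and> M \<subseteq> I \<longrightarrow> I = M \<or> I = carrier R)"

definition jacobson_radical :: "('a, 'm) ring_scheme \<Rightarrow> 'a set"
  where "jacobson_radical R = carrier R \<inter> \<Inter>{M. maximal_left_ideal M R}"

text \<open>
  \<open>j\<close> exhibits \<open>L\<close> as the localisation of \<open>R\<close> at \<open>S\<close>, i.e. as a ring of left fractions. This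
  determines \<open>L\<close> up to a unique isomorphism over \<open>R\<close>. If \<open>S\<close> consists of regular elements,
  the last clause says that \<open>j\<close> is injective.
\<close>
definition is_localisation ::
    "('a, 'm) ring_scheme \<Rightarrow> 'a set \<Rightarrow> ('b, 'n) ring_scheme \<Rightarrow> ('a \<Rightarrow> 'b) \<Rightarrow> bool"
  where "is_localisation R S L j \<longleftrightarrow>
    ring R \<and> ring L \<and> S \<subseteq> carrier R \<and> j \<in> ring_hom R L \<and>
    (\<forall>s\<in>S. j s \<in> Units L) \<and>
    (\<forall>y\<in>carrier L. \<exists>s\<in>S. \<exists>r\<in>carrier R. y = inv\<^bsub>L\<^esub> (j s) \<otimes>\<^bsub>L\<^esub> j r) \<and>
    (\<forall>r\<in>carrier R. j r = \<zero>\<^bsub>L\<^esub> \<longleftrightarrow> (\<exists>s\<in>S. s \<otimes>\<^bsub>R\<^esub> r = \<zero>\<^bsub>R\<^esub>))"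


text \<open>
  The tensor product \<open>A \<otimes>\<^sub>K B\<close> as an abelian group, where \<open>K\<close> acts on \<open>A\<close> from the right through
  \<open>\<phi>\<close> and on \<open>B\<close> from the left through \<open>\<psi>\<close>: the free abelian group on the pairs \<open>(a, b)\<close> modulo
  the biadditivity and balancing relations.
\<close>
definition tensor_relations ::
    "('a, 'm) ring_scheme \<Rightarrow> ('b, 'n) ring_scheme \<Rightarrow> 'c set \<Rightarrow> ('c \<Rightarrow> 'a) \<Rightarrow> ('c \<Rightarrow> 'b) \<Rightarrow>
     ('a \<times> 'b \<Rightarrow>\<^sub>0 int) set"
  where "tensor_relations A B K \<phi> \<psi> = generate (free_Abelian_group (carrier A \<times> carrier B))
    ({frag_of (a \<oplus>\<^bsub>A\<^esub> a', b) - frag_of (a, b) - frag_of (a', b) | a a' b.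
        a \<in> carrier A \<and> a' \<in> carrier A \<and> b \<in> carrier B} \<union>
     {frag_of (a, b \<oplus>\<^bsub>B\<^esub> b') - frag_of (a, b) - frag_of (a, b') | a b b'.
        a \<in> carrier A \<and> b \<in> carrier B \<and> b' \<in> carrier B} \<union>
     {frag_of (a \<otimes>\<^bsub>A\<^esub> \<phi> r, b) - frag_of (a, \<psi> r \<otimes>\<^bsub>B\<^esub> b) | a r b.
        a \<in> carrier A \<and> r \<in> K \<and> b \<in> carrier B})"

definition tensor_group ::
    "('a, 'm) ring_scheme \<Rightarrow> ('b, 'n) ring_scheme \<Rightarrow> 'c set \<Rightarrow> ('c \<Rightarrow> 'a) \<Rightarrow> ('c \<Rightarrow> 'b) \<Rightarrow>
     ('a \<times> 'b \<Rightarrow>\<^sub>0 int) set monoid"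
  where "tensor_group A B K \<phi> \<psi> =
    free_Abelian_group (carrier A \<times> carrier B) Mod tensor_relations A B K \<phi> \<psi>"

definition pure_tensor ::
    "('a, 'm) ring_scheme \<Rightarrow> ('b, 'n) ring_scheme \<Rightarrow> 'c set \<Rightarrow> ('c \<Rightarrow> 'a) \<Rightarrow> ('c \<Rightarrow> 'b) \<Rightarrow>
     'a \<Rightarrow> 'b \<Rightarrow> ('a \<times> 'b \<Rightarrow>\<^sub>0 int) set"
  where "pure_tensor A B K \<phi> \<psi> a b =
    tensor_relations A B K \<phi> \<psi> #>\<^bsub>free_Abelian_group (carrier A \<times> carrier B)\<^esub> frag_of (a, b)"

text \<open>
  \<open>T\<close> is the abelian group \<open>A \<otimes>\<^sub>K B\<close> with a multiplication that makes \<open>b \<mapsto> 1 \<otimes> b\<close> the localisation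
  of \<open>B\<close> at \<open>S\<close> and \<open>a \<mapsto> a \<otimes> 1\<close> a ring homomorphism, and that satisfies
  \<open>a \<otimes> b = (a \<otimes> 1) (1 \<otimes> b)\<close>. If \<open>A\<close> is a localisation of \<open>K\<close> at elements that \<open>\<psi>\<close> sends to \<open>S\<close>,
  then every element of \<open>T\<close> is of the form \<open>(1 \<otimes> s)\<inverse> (1 \<otimes> b) = s\<inverse> \<otimes> b\<close> and the
  multiplication is uniquely determined.
\<close>
definition localised_tensor_ring ::
    "('a, 'm) ring_scheme \<Rightarrow> ('b, 'n) ring_scheme \<Rightarrow> 'c set \<Rightarrow> ('c \<Rightarrow> 'a) \<Rightarrow> ('c \<Rightarrow> 'b) \<Rightarrow>
     'b set \<Rightarrow> ('a \<times> 'b \<Rightarrow>\<^sub>0 int) set ring \<Rightarrow> bool"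
  where "localised_tensor_ring A B K \<phi> \<psi> S T \<longleftrightarrow>
    carrier T = carrier (tensor_group A B K \<phi> \<psi>) \<and>
    add T = monoid.mult (tensor_group A B K \<phi> \<psi>) \<and>
    \<zero>\<^bsub>T\<^esub> = \<one>\<^bsub>tensor_group A B K \<phi> \<psi>\<^esub> \<and>
    is_localisation B S T (pure_tensor A B K \<phi> \<psi> \<one>\<^bsub>A\<^esub>) \<and>
    (\<lambda>a. pure_tensor A B K \<phi> \<psi> a \<one>\<^bsub>B\<^esub>) \<in> ring_hom A T \<and>
    (\<forall>a\<in>carrier A. \<forall>b\<in>carrier B. pure_tensor A B K \<phi> \<psi> a b =
       pure_tensor A B K \<phi> \<psi> a \<one>\<^bsub>B\<^esub> \<otimes>\<^bsub>T\<^esub> pure_tensor A B K \<phi> \<psi> \<one>\<^bsub>A\<^esub> b)"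

subsection \<open>Discrete valuation rings and their filtrations\<close>

text \<open>
  The condition makes \<open>D\<close> a subring of the division ring \<open>'f\<close>, hence a domain. The two clauses
  with fractions say that \<open>'f\<close> is its division ring of quotients.
\<close>
definition discrete_valuation_ring :: "'f::division_ring set \<Rightarrow> bool"
  where "discrete_valuation_ring D \<longleftrightarrow>
    subring D (ring_of_type_algebra :: 'f ring) \<and>
    two_sided_noetherian (subring_of_type D) \<and>
    (\<forall>z. \<exists>a\<in>D. \<exists>b\<in>D. b \<noteq> 0 \<and> z = a * inverse b) \<and>
    (\<forall>z. \<exists>a\<in>D. \<exists>b\<in>D. b \<noteq> 0 \<and> z = inverse b * a) \<and>
    (\<forall>z. z \<noteq> 0 \<longrightarrow> z \<in> D \<or> inverse z \<in> D)"

definition uniformiser :: "'f::division_ring set \<Rightarrow> 'f \<Rightarrow> bool"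
  where "uniformiser D \<pi> \<longleftrightarrow>
    \<pi> \<in> D \<and>
    jacobson_radical (subring_of_type D) = (\<lambda>d. \<pi> * d) ` D \<and>
    jacobson_radical (subring_of_type D) = (\<lambda>d. d * \<pi>) ` D"

text \<open>
  Filtrations take values in \<open>\<int> \<union> {\<infinity>}\<close>, viewed inside \<^typ>\<open>ereal\<close>. The exponent \<open>k\<close> ranges over
  all integers. If the Jacobson radical is zero, then \<open>\<pi> = 0\<close> and \<open>\<pi> powi k = 0\<close> for \<open>k \<noteq> 0\<close>, so
  that nonzero elements have value \<open>0\<close>.
\<close>
definition dvr_filtration :: "'f::division_ring set \<Rightarrow> 'f \<Rightarrow> 'f \<Rightarrow> ereal"
  where "dvr_filtration D \<pi> z =
    (SUP k\<in>{k::int. z \<in> (\<lambda>d. \<pi> powi k * d) ` D}. ereal (of_int k))"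

definition filt_tendsto :: "('a::ab_group_add \<Rightarrow> ereal) \<Rightarrow> (nat \<Rightarrow> 'a) \<Rightarrow> 'a \<Rightarrow> bool"
  where "filt_tendsto v s l \<longleftrightarrow> (\<lambda>m. v (s m - l)) \<longlonglongrightarrow> \<infinity>"

definition filt_Cauchy :: "('a::ab_group_add \<Rightarrow> ereal) \<Rightarrow> (nat \<Rightarrow> 'a) \<Rightarrow> bool"
  where "filt_Cauchy v s \<longleftrightarrow>
    (\<forall>B::real. \<exists>M. \<forall>m\<ge>M. \<forall>m'\<ge>M. ereal B \<le> v (s m - s m'))"

definition filt_complete :: "('a::ab_group_add \<Rightarrow> ereal) \<Rightarrow> 'a set \<Rightarrow> bool"
  where "filt_complete v A \<longleftrightarrow>
    (\<forall>s. (\<forall>m. s m \<in> A) \<and> filt_Cauchy v s \<longrightarrow> (\<exists>l\<in>A. filt_tendsto v s l))"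

definition filt_suminf :: "('a::ab_group_add \<Rightarrow> ereal) \<Rightarrow> (nat \<Rightarrow> 'a) \<Rightarrow> 'a"
  where "filt_suminf v a = (THE l. filt_tendsto v (\<lambda>N. \<Sum>i<N. a i) l)"


subsection \<open>Matrices\<close>

definition matrix_ring :: "('f::ring_1 ^ 'n ^ 'n) ring"
  where "matrix_ring =
    \<lparr>carrier = UNIV, monoid.mult = (**), one = mat 1, ring.zero = 0, add = (+)\<rparr>"

definition matrices_over :: "'f set \<Rightarrow> ('f ^ 'n ^ 'n) set"
  where "matrices_over D = {A. \<forall>i j. A $ i $ j \<in> D}"

definition matrix_filtration :: "('f \<Rightarrow> ereal) \<Rightarrow> 'f ^ 'n ^ 'n \<Rightarrow> ereal"
  where "matrix_filtration v A = Min (range (\<lambda>(i, j). v (A $ i $ j)))"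


subsection \<open>Skew polynomials and skew power series\<close>

definition skew_derivation :: "('q::ring_1 \<Rightarrow> 'q) \<Rightarrow> ('q \<Rightarrow> 'q) \<Rightarrow> bool"
  where "skew_derivation \<sigma> \<delta> \<longleftrightarrow>
    \<sigma> \<in> ring_iso ring_of_type_algebra ring_of_type_algebra \<and>
    (\<forall>r s. \<delta> (r + s) = \<delta> r + \<delta> s) \<and>
    (\<forall>r s. \<delta> (r * s) = \<delta> r * s + \<sigma> r * \<delta> s)"

definition filt_compatible :: "('q::ring_1 \<Rightarrow> ereal) \<Rightarrow> ('q \<Rightarrow> 'q) \<Rightarrow> ('q \<Rightarrow> 'q) \<Rightarrow> bool"
  where "filt_compatible v \<sigma> \<delta> \<longleftrightarrow> (\<forall>r. r \<noteq> 0 \<longrightarrow> v (\<sigma> r) = v r \<and> v (\<delta> r) > v r)"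

text \<open>
  \<open>skew_coeff \<sigma> \<delta> i m r\<close> is the coefficient of \<open>x\<^sup>m\<close> in \<open>x\<^sup>i r\<close> when this product is written with
  coefficients on the left. The recursion is the rule \<open>x s = \<sigma>(s) x + \<delta>(s)\<close> applied to each
  coefficient \<open>s\<close> of \<open>x\<^sup>i r\<close>.
\<close>
primrec skew_coeff :: "('q::ring_1 \<Rightarrow> 'q) \<Rightarrow> ('q \<Rightarrow> 'q) \<Rightarrow> nat \<Rightarrow> nat \<Rightarrow> 'q \<Rightarrow> 'q"
  where
    "skew_coeff \<sigma> \<delta> 0 m r = (if m = 0 then r else 0)"
  | "skew_coeff \<sigma> \<delta> (Suc i) m r =
       (if m = 0 then 0 else \<sigma> (skew_coeff \<sigma> \<delta> i (m - 1) r)) + \<delta> (skew_coeff \<sigma> \<delta> i m r)"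

text \<open>
  Polynomials and power series are represented by their sequences of left coefficients. Since
  \<open>p x\<^sup>i \<cdot> q x\<^sup>j = p (x\<^sup>i q) x\<^sup>j\<close>, the summand with index \<open>i\<close> below is the contribution of \<open>f i x\<^sup>i\<close>
  to the coefficient of \<open>x\<^sup>k\<close> in the product of \<open>f\<close> and \<open>g\<close>.
\<close>
definition skew_mult_term ::
    "('q::ring_1 \<Rightarrow> 'q) \<Rightarrow> ('q \<Rightarrow> 'q) \<Rightarrow> (nat \<Rightarrow> 'q) \<Rightarrow> (nat \<Rightarrow> 'q) \<Rightarrow> nat \<Rightarrow> nat \<Rightarrow> 'q"
  where "skew_mult_term \<sigma> \<delta> f g k i = (\<Sum>j\<le>k. f i * skew_coeff \<sigma> \<delta> i (k - j) (g j))"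

definition const_series :: "'q::zero \<Rightarrow> nat \<Rightarrow> 'q"
  where "const_series r = (\<lambda>i. if i = 0 then r else 0)"

definition skew_poly_ring ::
    "'q::ring_1 set \<Rightarrow> ('q \<Rightarrow> 'q) \<Rightarrow> ('q \<Rightarrow> 'q) \<Rightarrow> (nat \<Rightarrow> 'q) ring"
  where "skew_poly_ring R \<sigma> \<delta> =
    \<lparr>carrier = {f. (\<forall>i. f i \<in> R) \<and> finite {i. f i \<noteq> 0}},
     monoid.mult = (\<lambda>f g k. \<Sum>i\<in>{i. f i \<noteq> 0}. skew_mult_term \<sigma> \<delta> f g k i),
     one = const_series 1,
     ring.zero = (\<lambda>_. 0),
     add = (\<lambda>f g i. f i + g i)\<rparr>"

text \<open>
  In a product of power series the coefficients are infinite sums, which converge with respect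
  to \<open>v\<close> when \<open>R\<close> is complete and positively filtered and \<open>(\<sigma>, \<delta>)\<close> is compatible with \<open>v\<close>.
\<close>
definition skew_power_series_ring ::
    "'q::ring_1 set \<Rightarrow> ('q \<Rightarrow> ereal) \<Rightarrow> ('q \<Rightarrow> 'q) \<Rightarrow> ('q \<Rightarrow> 'q) \<Rightarrow> (nat \<Rightarrow> 'q) ring"
  where "skew_power_series_ring R v \<sigma> \<delta> =
    \<lparr>carrier = {f. \<forall>i. f i \<in> R},
     monoid.mult = (\<lambda>f g k. filt_suminf v (skew_mult_term \<sigma> \<delta> f g k)),
     one = const_series 1,
     ring.zero = (\<lambda>_. 0),
     add = (\<lambda>f g i. f i + g i)\<rparr>"

end

(*
  Write v for the filtration. Since v(delta r) > v r, a product of power series agrees modulo terms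
  of higher value with the product for the skew derivation (sigma, 0). A nonzero ideal I contains a
  nonzero f; let K be the least value of its coefficients and m the first index where K is attained.
  Multiplying f by constants and adding, one reaches an element of I whose coefficient at m is
  congruent to a unit u of Q of value K. Then Weierstrass division works: successive approximation,
  which converges by completeness, gives q such that f q has coefficient u at m and 0 beyond m. So
  f q is a nonzero polynomial in I.

  For the second claim, a nonzero ideal of the localisation T contracts to a nonzero ideal of the
  power series ring, hence contains a nonzero polynomial. Evaluation at 1 (x) x is a ring
  homomorphism Q[x; sigma, delta] -> T, so the ideal contracts to a nonzero ideal of the simple
  ring Q[x; sigma, delta] and contains 1.
*)
theory Submission
  imports Defs
begin

text \<open>The coefficient of least value need not be a unit: a matrix over \<open>F\<close> may
  have a small value and be singular. Two-sidedness of the ideal is what helps. Integral matrix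
  units spread a single entry of least value over the whole diagonal, and the resulting scalar
  matrix has an inverse of exactly opposite value. The locale axiom \<open>unit_of_value\<close>
  records this, so that the power series argument needs no matrices and the valuation theory of
  \<open>D\<close> can be kept apart from it. The obstacle is that right multiplication by a
  constant reaches the coefficient at \<open>m\<close> only through \<open>\<sigma> ^^ m\<close> and
  leaves \<delta>-terms behind. The twist is undone because \<sigma> is bijective and preserves
  values; the \<delta>-terms are invisible modulo higher value. Associativity and distributivity of
  the skew products are not derived from convergence of the sums. They enter with the hypotheses:
  \<open>ideal\<close>, \<open>is_localisation\<close> and \<open>simple_ring\<close> each include
  the ring axioms.\<close>

lemma course_of_values_recursion:
  fixes H :: "(nat \<Rightarrow> 'a) \<Rightarrow> nat \<Rightarrow> 'a"
  assumes "\<And>q q' j. (\<And>i. i < j \<Longrightarrow> q i = q' i) \<Longrightarrow> H q j = H q' j"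
  shows "\<exists>q. \<forall>j. q j = H q j"
proof -
  have "adm_wf less_than H"
    unfolding adm_wf_def less_than_iff using assms by blast
  then have "wfrec less_than H = H (wfrec less_than H)"
    by (rule wfrec_fixpoint[OF wf_less_than])
  then show ?thesis by metis
qed

subsection \<open>Skew derivations\<close>

lemma skew_derivationD:
  assumes "skew_derivation \<sigma> \<delta>"
  shows "bij \<sigma>" "\<sigma> (r + s) = \<sigma> r + \<sigma> s" "\<sigma> (r * s) = \<sigma> r * \<sigma> s" "\<sigma> 1 = 1"
    "\<delta> (r + s) = \<delta> r + \<delta> s" "\<delta> (r * s) = \<delta> r * s + \<sigma> r * \<delta> s"
  using assms
  by (auto simp: skew_derivation_def ring_iso_def ring_hom_def ring_of_type_algebra_def)

context
  fixes \<sigma> \<delta> :: "'q::ring_1 \<Rightarrow> 'q"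
  assumes skew: "skew_derivation \<sigma> \<delta>"
begin

lemma skew_zero: "\<sigma> 0 = 0" "\<delta> 0 = 0"
  using skew_derivationD(2)[OF skew, of 0 0] skew_derivationD(5)[OF skew, of 0 0] by auto

lemma skew_one: "\<delta> 1 = 0"
  using skew_derivationD(6)[OF skew, of 1 1] skew_derivationD(4)[OF skew] by auto

lemma skew_coeff_eq_0: "i < a \<Longrightarrow> skew_coeff \<sigma> \<delta> i a r = 0"
  by (induction i arbitrary: a) (auto simp: skew_zero)

lemma skew_coeff_diag: "skew_coeff \<sigma> \<delta> i i r = (\<sigma> ^^ i) r"
  by (induction i) (auto simp: skew_zero skew_coeff_eq_0)

lemma skew_coeff_zero: "skew_coeff \<sigma> \<delta> i a 0 = 0"
  by (induction i arbitrary: a) (auto simp: skew_zero)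

lemma skew_coeff_one: "skew_coeff \<sigma> \<delta> i a 1 = (if a = i then 1 else 0)"
  by (induction i arbitrary: a) (auto simp: skew_zero skew_one skew_derivationD(4)[OF skew])

lemma bij_funpow_skew: "bij (\<sigma> ^^ i)"
  using bij_fn skew_derivationD(1)[OF skew] .

end

subsection \<open>Filtered rings with a compatible skew derivation\<close>

text \<open>
  The last condition says that every two-sided ideal over the valuation ring which contains an
  element of value \<open>k\<close> contains a unit of value \<open>k\<close>.
\<close>
locale complete_filtered_skew_ring =
  fixes v :: "'q::ring_1 \<Rightarrow> ereal" and \<sigma> \<delta> :: "'q \<Rightarrow> 'q"
  assumes v_eq_infinity_iff: "v r = \<infinity> \<longleftrightarrow> r = 0"
    and v_integral: "r \<noteq> 0 \<Longrightarrow> \<exists>k::int. v r = ereal (of_int k)"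
    and v_diff: "min (v r) (v s) \<le> v (r - s)"
    and v_mult: "v r + v s \<le> v (r * s)"
    and v_one: "0 \<le> v 1"
    and complete: "filt_complete v {r. 0 \<le> v r}"
    and skew: "skew_derivation \<sigma> \<delta>"
    and compatible: "filt_compatible v \<sigma> \<delta>"
    and unit_of_value: "\<lbrakk>v r = ereal (of_int k); r \<in> J; 0 \<in> J;
        \<And>a b. a \<in> J \<Longrightarrow> b \<in> J \<Longrightarrow> a + b \<in> J;
        \<And>a b. a \<in> J \<Longrightarrow> 0 \<le> v b \<Longrightarrow> a * b \<in> J;
        \<And>a b. a \<in> J \<Longrightarrow> 0 \<le> v b \<Longrightarrow> b * a \<in> J\<rbrakk>
      \<Longrightarrow> \<exists>u\<in>J. \<exists>u'. u * u' = 1 \<and> u' * u = 1 \<and> ereal (of_int (- k)) \<le> v u'"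
begin

text \<open>Since values are integers or infinite, balls of integer radius determine the filtration,
  and estimates become membership rules. Negative radii occur for inverses such as \<open>u'\<close>
  and for elements that still need a denominator.\<close>

definition fball :: "int \<Rightarrow> 'q set"
  where "fball n = {r. ereal (of_int n) \<le> v r}"

abbreviation \<O> :: "'q set" where "\<O> \<equiv> fball 0"

lemma fball_0: "\<O> = {r. 0 \<le> v r}"
  by (simp add: fball_def zero_ereal_def)

lemma zero_in_fball [simp]: "0 \<in> fball n"
  using v_eq_infinity_iff[of 0] by (simp add: fball_def)

lemma fball_mono: "r \<in> fball n \<Longrightarrow> m \<le> n \<Longrightarrow> r \<in> fball m"
  unfolding fball_def mem_Collect_eq
  by (erule order_trans[rotated]) simp

lemma fball_diff: "r \<in> fball n \<Longrightarrow> s \<in> fball n \<Longrightarrow> r - s \<in> fball n"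
  unfolding fball_def mem_Collect_eq by (rule order_trans[OF _ v_diff]) simp

lemma fball_uminus: "r \<in> fball n \<Longrightarrow> - r \<in> fball n"
  using fball_diff[of 0 n r] by simp

lemma fball_add: "r \<in> fball n \<Longrightarrow> s \<in> fball n \<Longrightarrow> r + s \<in> fball n"
  using fball_diff[of r n "- s"] fball_uminus[of s n] by simp

lemma fball_sum: "(\<And>i. i \<in> I \<Longrightarrow> a i \<in> fball n) \<Longrightarrow> sum a I \<in> fball n"
  by (induction I rule: infinite_finite_induct) (auto intro: fball_add)

lemma fball_mult: "r \<in> fball m \<Longrightarrow> s \<in> fball n \<Longrightarrow> r * s \<in> fball (m + n)"
  unfolding fball_def mem_Collect_eq
  by (rule order_trans[OF _ v_mult], drule (1) add_mono) simp

lemma fball_mult': "r \<in> fball m \<Longrightarrow> s \<in> fball n \<Longrightarrow> k \<le> m + n \<Longrightarrow> r * s \<in> fball k"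
  using fball_mult fball_mono by blast

lemma fball_one: "1 \<in> \<O>"
  using v_one by (simp add: fball_0)

lemma fball_sigma: "\<sigma> r \<in> fball n \<longleftrightarrow> r \<in> fball n"
  using compatible skew_zero[OF skew]
  by (cases "r = 0") (auto simp: filt_compatible_def fball_def)

lemma fball_funpow: "(\<sigma> ^^ i) r \<in> fball n \<longleftrightarrow> r \<in> fball n"
  by (induction i) (auto simp: fball_sigma)

text \<open>A value strictly above an integer \<open>n\<close> is at least \<open>n + 1\<close>.
  This gain of one per application of \<delta> is what makes the coefficient sums of a product
  converge.\<close>

lemma fball_delta:
  assumes "r \<in> fball n" shows "\<delta> r \<in> fball (n + 1)"
proof (cases "\<delta> r = 0")
  case False
  then have "r \<noteq> 0" using skew_zero[OF skew] by auto
  obtain k :: int where k: "v (\<delta> r) = ereal (of_int k)" using v_integral[OF False] by auto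
  have "ereal (of_int n) < v (\<delta> r)"
    using compatible \<open>r \<noteq> 0\<close> assms by (auto simp: filt_compatible_def fball_def intro: le_less_trans)
  then have "n + 1 \<le> k" unfolding k by simp
  then show ?thesis unfolding fball_def mem_Collect_eq k ereal_less_eq of_int_le_iff .
qed simp

lemma fball_separated:
  assumes "\<And>n::nat. r \<in> fball (int n)" shows "r = 0"
proof (rule ccontr)
  assume "r \<noteq> 0"
  then obtain k where "v r = ereal (of_int k)" using v_integral by blast
  moreover have "k < int (nat (k + 1))" by simp
  ultimately show False using assms[of "nat (k + 1)"]
    by (simp add: fball_def del: of_nat_nat int_nat_eq)
qed

lemma v_eq_iff_fball:
  "v r = ereal (of_int k) \<longleftrightarrow> r \<in> fball k \<and> r \<notin> fball (k + 1)"
proof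
  assume *: "r \<in> fball k \<and> r \<notin> fball (k + 1)"
  then have "r \<noteq> 0" by auto
  then obtain l where "v r = ereal (of_int l)" using v_integral by blast
  with * have "k \<le> l" "\<not> k + 1 \<le> l"
    unfolding fball_def mem_Collect_eq ereal_less_eq of_int_le_iff by auto
  with \<open>v r = ereal (of_int l)\<close> show "v r = ereal (of_int k)" by simp
next
  assume "v r = ereal (of_int k)"
  then show "r \<in> fball k \<and> r \<notin> fball (k + 1)"
    by (simp only: fball_def mem_Collect_eq ereal_less_eq of_int_le_iff) simp
qed

section \<open>Convergence of series in the coefficient ring\<close>

lemma filt_tendsto_iff:
  "filt_tendsto v s l \<longleftrightarrow> (\<forall>n. eventually (\<lambda>m. s m - l \<in> fball n) sequentially)"
  unfolding filt_tendsto_def tendsto_PInfty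
proof safe
  fix n :: int
  assume "\<forall>r. \<forall>\<^sub>F x in sequentially. ereal r < v (s x - l)"
  then have "\<forall>\<^sub>F x in sequentially. ereal (of_int n) < v (s x - l)" by blast
  then show "\<forall>\<^sub>F m in sequentially. s m - l \<in> fball n"
    by (rule eventually_mono) (simp add: fball_def)
next
  fix r :: real
  assume *: "\<forall>n. \<forall>\<^sub>F m in sequentially. s m - l \<in> fball n"
  have "ereal r < ereal (of_int (\<lfloor>r\<rfloor> + 1))" by simp
  then show "\<forall>\<^sub>F x in sequentially. ereal r < v (s x - l)"
    by (intro eventually_mono[OF *[rule_format, of "\<lfloor>r\<rfloor> + 1"]])
      (auto simp only: fball_def mem_Collect_eq intro: less_le_trans)
qed

lemma filt_tendsto_unique:
  assumes "filt_tendsto v s l" "filt_tendsto v s l'" shows "l = l'"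
proof -
  have "l - l' \<in> fball n" for n
  proof -
    have "eventually (\<lambda>m. s m - l \<in> fball n \<and> s m - l' \<in> fball n) sequentially"
      using assms by (auto simp: filt_tendsto_iff intro: eventually_conj)
    then obtain m where "s m - l \<in> fball n" "s m - l' \<in> fball n"
      using eventually_happens'[OF sequentially_bot] by blast
    from fball_diff[OF this(2,1)] show ?thesis by simp
  qed
  then show ?thesis using fball_separated[of "l - l'"] by simp
qed

lemma filt_suminf_eqI:
  "filt_tendsto v (\<lambda>N. \<Sum>i<N. a i) l \<Longrightarrow> filt_suminf v a = l"
  unfolding filt_suminf_def by (blast intro: the_equality filt_tendsto_unique)

lemma filt_suminf_finite:
  assumes "\<And>i. N \<le> i \<Longrightarrow> a i = 0" shows "filt_suminf v a = (\<Sum>i<N. a i)"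
proof (rule filt_suminf_eqI)
  have "(\<Sum>i<M. a i) - (\<Sum>i<N. a i) \<in> fball n" if "N \<le> M" for M n
    using that assms by (subst sum.mono_neutral_right[of "{..<M}" "{..<N}"]) auto
  then show "filt_tendsto v (\<lambda>M. \<Sum>i<M. a i) (\<Sum>i<N. a i)"
    unfolding filt_tendsto_iff by (blast intro: eventually_sequentiallyI[of N])
qed

text \<open>\<open>small\<close> makes the partial sums Cauchy, and \<open>int\<close> keeps them in
  \<O>, the set that is assumed complete. The shift \<open>c\<close> leaves room for the index of
  the coefficient that is computed: in a product it is \<open>k\<close>.\<close>

lemma filt_suminf_tendsto:
  assumes int: "\<And>i. a i \<in> \<O>" and small: "\<And>i. a i \<in> fball (int i - c)"
  shows "filt_tendsto v (\<lambda>N. \<Sum>i<N. a i) (filt_suminf v a)"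
proof -
  have *: "(\<Sum>i<m'. a i) - (\<Sum>i<m. a i) \<in> fball n" if "m \<le> m'" "n \<le> int m - c" for m m' n
  proof -
    have "(\<Sum>i<m'. a i) - (\<Sum>i<m. a i) = sum a ({..<m'} - {..<m})"
      using that by (subst sum_diff) auto
    also have "\<dots> \<in> fball n"
      using that by (auto intro!: fball_sum fball_mono[OF small])
    finally show ?thesis .
  qed
  have "filt_Cauchy v (\<lambda>N. \<Sum>i<N. a i)"
    unfolding filt_Cauchy_def
  proof (intro allI exI[where x = "nat (\<lceil>B\<rceil> + c)" for B] impI)
    fix B :: real and m m'
    assume m: "nat (\<lceil>B\<rceil> + c) \<le> m" "nat (\<lceil>B\<rceil> + c) \<le> m'"
    have "(\<Sum>i<m. a i) - (\<Sum>i<m'. a i) \<in> fball \<lceil>B\<rceil>"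
    proof (cases "m \<le> m'")
      case True
      then show ?thesis using fball_uminus[OF *[of m m' "\<lceil>B\<rceil>"]] m by auto
    next
      case False
      then show ?thesis using *[of m' m "\<lceil>B\<rceil>"] m by auto
    qed
    then have "ereal (of_int \<lceil>B\<rceil>) \<le> v ((\<Sum>i<m. a i) - (\<Sum>i<m'. a i))" by (simp add: fball_def)
    moreover have "ereal B \<le> ereal (of_int \<lceil>B\<rceil>)" by simp
    ultimately show "ereal B \<le> v ((\<Sum>i<m. a i) - (\<Sum>i<m'. a i))" by (rule order_trans[rotated])
  qed
  moreover have "\<forall>N. (\<Sum>i<N. a i) \<in> {r. 0 \<le> v r}"
    using int fball_sum[of _ a 0] by (simp add: fball_0)
  ultimately obtain l where "filt_tendsto v (\<lambda>N. \<Sum>i<N. a i) l"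
    using complete[unfolded filt_complete_def, rule_format, of "\<lambda>N. \<Sum>i<N. a i"] by blast
  then show ?thesis using filt_suminf_eqI by metis
qed

text \<open>A termwise estimate passes to partial sums, and the limit differs from a late partial
  sum by an element of the ball. With the diagonal terms as \<open>b\<close> this isolates the
  leading part of a product, with \<open>b = a\<close> it estimates a tail, and with
  \<open>N = 0\<close> it bounds the whole sum.\<close>

lemma filt_suminf_approx:
  assumes int: "\<And>i. a i \<in> \<O>" and small: "\<And>i. a i \<in> fball (int i - c)"
    and approx: "\<And>i. a i - (if i < N then b i else 0) \<in> fball n"
  shows "filt_suminf v a - (\<Sum>i<N. b i) \<in> fball n"
proof -
  have "eventually (\<lambda>M. (\<Sum>i<M. a i) - filt_suminf v a \<in> fball n \<and> N \<le> M) sequentially"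
    using filt_suminf_tendsto[OF int small]
    by (auto simp: filt_tendsto_iff intro: eventually_conj eventually_ge_at_top)
  then obtain M where M: "(\<Sum>i<M. a i) - filt_suminf v a \<in> fball n" "N \<le> M"
    using eventually_happens'[OF sequentially_bot] by blast
  have "(\<Sum>i<N. b i) = (\<Sum>i<M. if i < N then b i else 0)"
    using M by (intro sum.mono_neutral_cong_left) auto
  then have "(\<Sum>i<M. a i) - (\<Sum>i<N. b i) \<in> fball n"
    by (auto simp flip: sum_subtractf intro!: fball_sum approx)
  from fball_diff[OF this M(1)] show ?thesis by simp
qed

lemma filt_suminf_in_fball:
  assumes "\<And>i. a i \<in> \<O>" "\<And>i. a i \<in> fball (int i - c)" "\<And>i. a i \<in> fball n"
  shows "filt_suminf v a \<in> fball n"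
  using filt_suminf_approx[of a c 0 "\<lambda>_. 0" n] assms by simp

text \<open>Each of the \<open>i\<close> moves of x past a coefficient applies either \<sigma>,
  which retains a power of x, or \<delta>, which consumes it. Arriving at \<open>x^a\<close> takes
  \<open>i - a\<close> applications of \<delta>, and each of them gains one in value.\<close>

lemma skew_coeff_fball:
  assumes "r \<in> fball n" shows "skew_coeff \<sigma> \<delta> i a r \<in> fball (n + int i - int a)"
proof (induction i arbitrary: a)
  case 0
  show ?case using assms by simp
next
  case (Suc i)
  have "\<delta> (skew_coeff \<sigma> \<delta> i a r) \<in> fball (n + int (Suc i) - int a)"
    using fball_delta[OF Suc.IH[of a]] by (simp add: algebra_simps)
  moreover have "\<sigma> (skew_coeff \<sigma> \<delta> i (a - 1) r) \<in> fball (n + int (Suc i) - int a)" if "a \<noteq> 0"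
    using Suc.IH[of "a - 1"] that by (simp add: fball_sigma of_nat_diff algebra_simps)
  ultimately show ?case by (auto intro: fball_add)
qed

section \<open>Products of power series up to higher value\<close>

abbreviation (input) series_ring :: "(nat \<Rightarrow> 'q) ring"
  where "series_ring \<equiv> skew_power_series_ring \<O> v \<sigma> \<delta>"

lemma series_ring_simps:
  "carrier series_ring = {f. \<forall>i. f i \<in> \<O>}"
  "f \<otimes>\<^bsub>series_ring\<^esub> g = (\<lambda>k. filt_suminf v (skew_mult_term \<sigma> \<delta> f g k))"
  "f \<oplus>\<^bsub>series_ring\<^esub> g = (\<lambda>k. f k + g k)"
  "\<zero>\<^bsub>series_ring\<^esub> = (\<lambda>_. 0)"
  "\<one>\<^bsub>series_ring\<^esub> = const_series 1"
  by (simp_all add: skew_power_series_ring_def)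

text \<open>The term \<open>f i x^i\<close> reaches \<open>x^k\<close> only through at least
  \<open>i - k\<close> applications of \<delta>. So for fixed \<open>k\<close> the contributions
  tend to 0 as \<open>i\<close> grows, with no condition on the decay of \<open>f\<close> or
  \<open>g\<close>.\<close>

lemma skew_mult_term_small:
  assumes "\<And>i. f i \<in> \<O>" "\<And>i. g i \<in> \<O>"
  shows "skew_mult_term \<sigma> \<delta> f g k i \<in> fball (int i - int k)"
  unfolding skew_mult_term_def
  using assms by (auto intro!: fball_sum fball_mult'[OF _ skew_coeff_fball])

lemma skew_mult_term_fball:
  assumes "\<And>i. f i \<in> fball m" "\<And>i. g i \<in> fball n"
  shows "skew_mult_term \<sigma> \<delta> f g k i \<in> fball (m + n)"
  unfolding skew_mult_term_def
proof (rule fball_sum)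
  fix j
  show "f i * skew_coeff \<sigma> \<delta> i (k - j) (g j) \<in> fball (m + n)"
  proof (cases "k - j \<le> i")
    case True
    then show ?thesis by (intro fball_mult'[OF assms(1) skew_coeff_fball[OF assms(2)]]) simp
  qed (simp add: skew_coeff_eq_0[OF skew])
qed

lemma series_mult_fball:
  assumes "\<And>i. f i \<in> \<O>" "\<And>i. g i \<in> \<O>" "\<And>i. f i \<in> fball m" "\<And>i. g i \<in> fball n"
  shows "(f \<otimes>\<^bsub>series_ring\<^esub> g) k \<in> fball (m + n)"
  unfolding series_ring_simps
  using assms skew_mult_term_fball[of f 0 g 0]
  by (intro filt_suminf_in_fball[where c = "int k"] skew_mult_term_small skew_mult_term_fball) auto

text \<open>Only the coefficient of \<open>x^i\<close> in \<open>x^i r\<close>, which is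
  \<open>(\<sigma> ^^ i) r\<close>, is formed without \<delta>. Integrality, in \<open>fg\<close>,
  is there for convergence, whereas \<open>m\<close> and \<open>n\<close> set the precision.\<close>

lemma series_mult_leading:
  assumes fg: "\<And>i. f i \<in> \<O>" "\<And>i. g i \<in> \<O>" and f: "\<And>i. f i \<in> fball m"
    and g: "\<And>i. g i \<in> fball n"
  shows "(f \<otimes>\<^bsub>series_ring\<^esub> g) k - (\<Sum>l\<le>k. f (k - l) * (\<sigma> ^^ (k - l)) (g l)) \<in> fball (m + n + 1)"
proof -
  let ?b = "\<lambda>i. f i * (\<sigma> ^^ i) (g (k - i))"
  \<comment> \<open>For \<open>a < i\<close> at least one \<delta> has been applied and gains one in
    value; for \<open>a > i\<close> the coefficient vanishes.\<close>
  have off_diag: "f i * skew_coeff \<sigma> \<delta> i a (g j) \<in> fball (m + n + 1)" if "a \<noteq> i" for i a j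
  proof (cases "a < i")
    case True
    then show ?thesis by (intro fball_mult'[OF f skew_coeff_fball[OF g]]) simp
  qed (use that in \<open>simp add: skew_coeff_eq_0[OF skew]\<close>)
  have "skew_mult_term \<sigma> \<delta> f g k i - (if i < Suc k then ?b i else 0) \<in> fball (m + n + 1)" for i
  proof (cases "i \<le> k")
    case True
    have "skew_mult_term \<sigma> \<delta> f g k i - ?b i =
        (\<Sum>j\<in>{..k} - {k - i}. f i * skew_coeff \<sigma> \<delta> i (k - j) (g j))"
      unfolding skew_mult_term_def
      using True by (subst sum.remove[of _ "k - i"]) (auto simp: skew_coeff_diag[OF skew])
    also have "\<dots> \<in> fball (m + n + 1)"
      using True by (intro fball_sum off_diag) auto
    finally show ?thesis using True by simp
  next
    case False
    then show ?thesis
      unfolding skew_mult_term_def by (auto intro!: fball_sum off_diag)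
  qed
  then have "filt_suminf v (skew_mult_term \<sigma> \<delta> f g k) - (\<Sum>i<Suc k. ?b i) \<in> fball (m + n + 1)"
    using skew_mult_term_fball[of f 0 g 0] fg
    by (intro filt_suminf_approx[where c = "int k"] skew_mult_term_small) auto
  moreover have "(\<Sum>l\<le>k. f (k - l) * (\<sigma> ^^ (k - l)) (g l)) = (\<Sum>i<Suc k. ?b i)"
    by (rule sum.reindex_bij_witness[of _ "\<lambda>i. k - i" "\<lambda>i. k - i"]) auto
  ultimately show ?thesis by (simp add: series_ring_simps)
qed

lemma const_series_mult: "const_series a \<otimes>\<^bsub>series_ring\<^esub> f = (\<lambda>k. a * f k)"
proof
  fix k
  have "filt_suminf v (skew_mult_term \<sigma> \<delta> (const_series a) f k)
      = (\<Sum>i<1. skew_mult_term \<sigma> \<delta> (const_series a) f k i)"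
    by (rule filt_suminf_finite) (simp add: skew_mult_term_def const_series_def)
  also have "\<dots> = (\<Sum>j\<le>k. a * skew_coeff \<sigma> \<delta> 0 (k - j) (f j))"
    by (simp add: skew_mult_term_def const_series_def)
  also have "\<dots> = (\<Sum>j\<le>k. if j = k then a * f k else 0)"
    by (rule sum.cong) auto
  finally show "(const_series a \<otimes>\<^bsub>series_ring\<^esub> f) k = a * f k"
    by (simp add: series_ring_simps)
qed

text \<open>A constant on the right has to be moved past \<open>x^k\<close>, which twists it by
  \<open>\<sigma> ^^ k\<close> and leaves \<delta>-terms behind. Hence a congruence only, whereas
  \<open>const_series_mult\<close> is exact.\<close>

lemma series_mult_const_leading:
  assumes "\<And>i. f i \<in> \<O>" "b \<in> \<O>" "\<And>i. f i \<in> fball m"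
  shows "(f \<otimes>\<^bsub>series_ring\<^esub> const_series b) k - f k * (\<sigma> ^^ k) b \<in> fball (m + 1)"
proof -
  have "(\<sigma> ^^ i) 0 = 0" for i by (induction i) (auto simp: skew_zero[OF skew])
  then have "(\<Sum>l\<le>k. f (k - l) * (\<sigma> ^^ (k - l)) (const_series b l)) =
      (\<Sum>l\<le>k. if l = 0 then f k * (\<sigma> ^^ k) b else 0)"
    by (intro sum.cong) (auto simp: const_series_def)
  then show ?thesis
    using series_mult_leading[of f "const_series b" m 0 k] assms
    by (simp add: const_series_def)
qed

subsection \<open>Weierstrass division\<close>

context
  fixes f :: "nat \<Rightarrow> 'q" and K :: int and m :: nat and u u' :: 'q
  assumes f_int: "\<And>i. f i \<in> \<O>" and f_ball: "\<And>i. f i \<in> fball K"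
    and f_low: "\<And>i. i < m \<Longrightarrow> f i \<in> fball (K + 1)"
    and f_lead: "f m - u \<in> fball (K + 1)"
    and u_inv: "u * u' = 1" "u' * u = 1" "u' \<in> fball (- K)"
begin

text \<open>Modulo value \<open>K + N + 1\<close> the coefficients of \<open>f q\<close> at the
  places \<open>m + j\<close> form a triangular system. The terms with \<open>q l\<close> for
  \<open>l > j\<close> involve \<open>f i\<close> with \<open>i < m\<close> and are negligible, and
  \<open>q j\<close> itself occurs as \<open>u * (\<sigma> ^^ m) (q j)\<close>. So each
  \<open>q j\<close> can be solved for once the earlier ones are known.\<close>

lemma weierstrass_division_step:
  assumes e: "\<And>j. e j \<in> fball (K + int N)"
  shows "\<exists>q. (\<forall>j. q j \<in> fball (int N)) \<and>
    (\<forall>j. e j - (f \<otimes>\<^bsub>series_ring\<^esub> q) (m + j) \<in> fball (K + int N + 1))"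
proof -
  define \<tau> where "\<tau> = inv_into UNIV (\<sigma> ^^ m)"
  have \<tau>: "(\<sigma> ^^ m) (\<tau> x) = x" for x
    unfolding \<tau>_def using bij_funpow_skew[OF skew] by (simp add: bij_is_surj surj_f_inv_f)
  \<comment> \<open>The part of the coefficient at \<open>m + j\<close> that the earlier
    \<open>q l\<close> have already fixed.\<close>
  let ?low = "\<lambda>q j. \<Sum>l<j. f (m + j - l) * (\<sigma> ^^ (m + j - l)) (q l)"
  obtain q where q: "\<And>j. q j = \<tau> (u' * (e j - ?low q j))"
    using course_of_values_recursion[of "\<lambda>q j. \<tau> (u' * (e j - ?low q j))"] by force
  have q_ball: "q j \<in> fball (int N)" for j
  proof (induction j rule: less_induct)
    case (less j)
    have "?low q j \<in> fball (K + int N)"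
      using less by (auto intro!: fball_sum fball_mult f_ball simp: fball_funpow)
    \<comment> \<open>Multiplication by \<open>u'\<close> may lose \<open>K\<close>, which is just
      the surplus of \<open>e\<close> over the precision \<open>N\<close> wanted for
      \<open>q\<close>.\<close>
    then have "u' * (e j - ?low q j) \<in> fball (int N)"
      by (intro fball_mult'[OF u_inv(3) fball_diff[OF e]]) auto
    then have "(\<sigma> ^^ m) (q j) \<in> fball (int N)" by (subst q) (simp only: \<tau>)
    then show ?case by (simp add: fball_funpow)
  qed
  have "e j - (f \<otimes>\<^bsub>series_ring\<^esub> q) (m + j) \<in> fball (K + int N + 1)" for j
  proof -
    let ?k = "m + j"
    let ?t = "\<lambda>l. f (?k - l) * (\<sigma> ^^ (?k - l)) (q l)"
    have "{..?k} = {..<Suc j} \<union> {j<..?k}" by auto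
    then have "(\<Sum>l\<le>?k. ?t l) = (\<Sum>l<Suc j. ?t l) + (\<Sum>l\<in>{j<..?k}. ?t l)"
      by (simp only:) (rule sum.union_disjoint, auto)
    then have split: "(\<Sum>l\<le>?k. ?t l) = ?low q j + ?t j + (\<Sum>l\<in>{j<..?k}. ?t l)"
      by simp
    have "(\<sigma> ^^ m) (q j) = u' * (e j - ?low q j)" by (subst q) (simp only: \<tau>)
    moreover have "?t j = (f m - u) * (\<sigma> ^^ m) (q j) + u * (\<sigma> ^^ m) (q j)"
      by (simp add: left_diff_distrib)
    ultimately have "?t j = (f m - u) * (\<sigma> ^^ m) (q j) + u * (u' * (e j - ?low q j))"
      by simp
    also have "u * (u' * (e j - ?low q j)) = e j - ?low q j"
      using u_inv(1) by (simp flip: mult.assoc)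
    finally have "e j - (\<Sum>l\<le>?k. ?t l) =
        - ((f m - u) * (\<sigma> ^^ m) (q j) + (\<Sum>l\<in>{j<..?k}. ?t l))"
      unfolding split by simp
    also have "\<dots> \<in> fball (K + int N + 1)"
    proof (intro fball_uminus fball_add fball_sum)
      show "(f m - u) * (\<sigma> ^^ m) (q j) \<in> fball (K + int N + 1)"
        using q_ball by (intro fball_mult'[OF f_lead, of _ "int N"]) (auto simp: fball_funpow)
      show "?t l \<in> fball (K + int N + 1)" if "l \<in> {j<..?k}" for l
        using q_ball that
        by (intro fball_mult'[OF f_low, of _ _ "int N"]) (auto simp: fball_funpow)
    qed
    finally have "e j - (\<Sum>l\<le>?k. ?t l) \<in> fball (K + int N + 1)" .
    moreover have "(f \<otimes>\<^bsub>series_ring\<^esub> q) ?k - (\<Sum>l\<le>?k. ?t l) \<in> fball (K + int N + 1)"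
      by (rule series_mult_leading) (auto intro: f_int f_ball q_ball fball_mono[OF q_ball])
    ultimately show ?thesis using fball_diff by fastforce
  qed
  with q_ball show ?thesis by blast
qed

text \<open>The quotient is an infinite sum of corrections, but the product is only ever distributed
  over finitely many of them and a tail. By \<open>series_mult_fball\<close> the product with the
  tail is as small as the tail, so the equation holds modulo every ball and therefore
  exactly.\<close>

lemma weierstrass_division:
  assumes ring: "ring series_ring" and "0 \<le> K" and u_ball: "u \<in> fball K"
  shows "\<exists>q\<in>carrier series_ring.
    \<forall>j. (f \<otimes>\<^bsub>series_ring\<^esub> q) (m + j) = (if j = 0 then u else 0)"
proof -
  interpret ring series_ring by fact
  define quot where "quot N e q \<longleftrightarrow> (\<forall>j. q j \<in> fball (int N)) \<and>
      (\<forall>j. e j - (f \<otimes>\<^bsub>series_ring\<^esub> q) (m + j) \<in> fball (K + int N + 1))" for N e q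
  \<comment> \<open>Quotients are chosen for all errors at once, because the error of a round is
    known only after the quotients of the previous rounds.\<close>
  have "\<exists>s. \<forall>N e. (\<forall>j. e j \<in> fball (K + int N)) \<longrightarrow> quot N e (s N e)"
    using weierstrass_division_step unfolding quot_def[symmetric] by (intro choice allI) blast
  then obtain s where s: "\<And>N e. (\<And>j. e j \<in> fball (K + int N)) \<Longrightarrow>
      (\<forall>j. s N e j \<in> fball (int N)) \<and>
      (\<forall>j. e j - (f \<otimes>\<^bsub>series_ring\<^esub> s N e) (m + j) \<in> fball (K + int N + 1))"
    unfolding quot_def by blast
  \<comment> \<open>\<open>E N\<close> is the error left after \<open>N\<close> rounds. It starts
    with the coefficients prescribed at \<open>m\<close>, \<open>m + 1\<close> and so on:
    \<open>u\<close> followed by zeros.\<close>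
  define E where "E = rec_nat (\<lambda>j::nat. if j = 0 then u else 0)
      (\<lambda>N e j. e j - (f \<otimes>\<^bsub>series_ring\<^esub> s N e) (m + j))"
  have E0: "E 0 = (\<lambda>j. if j = 0 then u else 0)"
    and ESuc: "E (Suc N) = (\<lambda>j. E N j - (f \<otimes>\<^bsub>series_ring\<^esub> s N (E N)) (m + j))" for N
    by (simp_all add: E_def)
  have E: "\<forall>j. E N j \<in> fball (K + int N)" for N
  proof (induction N)
    case (Suc N)
    then show ?case using s[of "E N" N] by (simp add: ESuc algebra_simps)
  qed (simp add: E0 u_ball)
  define t where "t N = s N (E N)" for N
  have t: "t N j \<in> fball (int N)" for N j using s[of "E N" N] E by (simp add: t_def)
  have t0: "t N j \<in> \<O>" for N j using fball_mono[OF t] by simp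
  define Q where "Q j = filt_suminf v (\<lambda>N. t N j)" for j
  have Q: "Q j - (\<Sum>N<n. t N j) \<in> fball (int n)" for j n
    unfolding Q_def
    by (rule filt_suminf_approx[where c = 0]) (auto intro: t t0 fball_mono[OF t])
  have "Q j \<in> \<O>" for j using Q[of j 0] by simp
  then have Q_carr: "Q \<in> carrier series_ring" by (simp add: series_ring_simps)
  have f_carr: "f \<in> carrier series_ring" using f_int by (simp add: series_ring_simps)
  have partial_carr: "(\<lambda>j. \<Sum>N<n. t N j) \<in> carrier series_ring" for n
    using t0 by (auto simp: series_ring_simps intro: fball_sum)
  have partial: "(f \<otimes>\<^bsub>series_ring\<^esub> (\<lambda>j. \<Sum>N<n. t N j)) (m + j) = E 0 j - E n j" for n j
  proof (induction n)
    case 0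
    show ?case using r_null[OF f_carr] by (simp add: series_ring_simps fun_eq_iff)
  next
    case (Suc n)
    have "t n \<in> carrier series_ring" using t0 by (simp add: series_ring_simps)
    from r_distr[OF partial_carr[of n] this f_carr]
    show ?case using Suc by (simp add: series_ring_simps(3) ESuc t_def)
  qed
  have "(f \<otimes>\<^bsub>series_ring\<^esub> Q) (m + j) = E 0 j" for j
  proof -
    have "(f \<otimes>\<^bsub>series_ring\<^esub> Q) (m + j) - E 0 j \<in> fball (int n)" for n
    proof -
      let ?P = "\<lambda>j. \<Sum>N<n. t N j" and ?R = "\<lambda>j. Q j - (\<Sum>N<n. t N j)"
      have R: "?R j \<in> \<O>" for j using fball_mono[OF Q] by simp
      then have "?R \<in> carrier series_ring" by (simp add: series_ring_simps)
      from r_distr[OF partial_carr[of n] this f_carr]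
      have "f \<otimes>\<^bsub>series_ring\<^esub> Q = (\<lambda>k. (f \<otimes>\<^bsub>series_ring\<^esub> ?P) k + (f \<otimes>\<^bsub>series_ring\<^esub> ?R) k)"
        by (simp add: series_ring_simps(3))
      then have "(f \<otimes>\<^bsub>series_ring\<^esub> Q) (m + j) - E 0 j = (f \<otimes>\<^bsub>series_ring\<^esub> ?R) (m + j) - E n j"
        by (simp add: partial)
      also have "\<dots> \<in> fball (int n)"
      proof (rule fball_diff)
        show "(f \<otimes>\<^bsub>series_ring\<^esub> ?R) (m + j) \<in> fball (int n)"
          using series_mult_fball[of f ?R 0 "int n"] f_int R Q by simp
        show "E n j \<in> fball (int n)" using E[of n] \<open>0 \<le> K\<close> by (auto intro: fball_mono)
      qed
      finally show ?thesis .
    qed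
    from fball_separated[OF this] show ?thesis by simp
  qed
  with Q_carr show ?thesis unfolding E0 by blast
qed

end

section \<open>Nonzero polynomials in a nonzero ideal\<close>

theorem ideal_meets_polynomials:
  assumes "ideal I series_ring" "I \<noteq> {\<zero>\<^bsub>series_ring\<^esub>}"
  shows "\<exists>w\<in>I. w \<noteq> \<zero>\<^bsub>series_ring\<^esub> \<and> finite {i. w i \<noteq> 0}"
proof -
  interpret ideal I series_ring by fact
  have carr: "\<And>f i. f \<in> I \<Longrightarrow> f i \<in> \<O>" using Icarr by (auto simp: series_ring_simps)
  note I_zero = additive_subgroup.zero_closed[OF additive_subgroup_axioms]
  note I_add = additive_subgroup.a_closed[OF additive_subgroup_axioms]
  from I_zero assms(2) obtain f where f: "f \<in> I" "f \<noteq> (\<lambda>_. 0)" by (auto simp: series_ring_simps(4))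
  then obtain i0 where i0: "f i0 \<noteq> 0" by blast
  let ?P = "\<lambda>n::nat. \<forall>i. f i \<in> fball (int n)"
  obtain n0 :: nat where n0: "f i0 \<notin> fball (int n0)" using i0 fball_separated by blast
  have bound: "n \<le> n0" if "?P n" for n
    using n0 fball_mono[of "f i0" "int n" "int n0"] that by force
  have "?P 0" using carr f by simp
  \<comment> \<open>The radii satisfying \<open>?P\<close> are bounded because \<open>f i0\<close>
    has finite value. The greatest of them is the least value of a coefficient of
    \<open>f\<close>.\<close>
  define k where "k = Greatest ?P"
  have k: "?P k" "\<And>n. ?P n \<Longrightarrow> n \<le> k"
    unfolding k_def
    by (rule GreatestI_nat[of ?P, OF \<open>?P 0\<close> bound], assumption)
      (rule Greatest_le_nat[of ?P, OF _ bound])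
  define K where "K = int k"
  have "\<not> ?P (Suc k)" using k(2) by fastforce
  then have ex: "\<exists>i. f i \<notin> fball (K + 1)" by (simp add: K_def add.commute)
  define m where "m = (LEAST i. f i \<notin> fball (K + 1))"
  have m: "f m \<notin> fball (K + 1)" using LeastI_ex[OF ex] by (simp add: m_def)
  have low: "i < m \<Longrightarrow> f i \<in> fball (K + 1)" for i using not_less_Least m_def by blast
  have fK: "f i \<in> fball K" for i using k(1) by (simp add: K_def)
  \<comment> \<open>The coefficients at \<open>m\<close> of those elements of \<open>I\<close> that
    obey the same bounds as \<open>f\<close>, blurred by elements of value above \<open>K\<close>.
    The blurring absorbs the \<delta>-terms of right multiplication, so \<open>J\<close> is stable
    under \<O> on both sides and \<open>unit_of_value\<close> applies to it.\<close>
  define J where "J = {b. \<exists>g\<in>I. (\<forall>i. g i \<in> fball K) \<and> (\<forall>i<m. g i \<in> fball (K + 1)) \<and>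
      g m - b \<in> fball (K + 1)}"
  have J_I: "b \<in> J" if "g \<in> I" "\<And>i. g i \<in> fball K" "\<And>i. i < m \<Longrightarrow> g i \<in> fball (K + 1)"
    "g m - b \<in> fball (K + 1)" for g b
    unfolding J_def using that by blast
  have "\<exists>u\<in>J. \<exists>u'. u * u' = 1 \<and> u' * u = 1 \<and> ereal (of_int (- K)) \<le> v u'"
  proof (rule unit_of_value[of "f m"])
    show "v (f m) = ereal (of_int K)" using m fK by (simp add: v_eq_iff_fball)
    show "f m \<in> J" by (rule J_I[OF f(1) fK low]) simp_all
    show "0 \<in> J" by (rule J_I[OF I_zero]) (simp_all add: series_ring_simps)
    show "a + b \<in> J" if ab: "a \<in> J" "b \<in> J" for a b
    proof -
      obtain g where g: "g \<in> I" "\<forall>i. g i \<in> fball K" "\<forall>i<m. g i \<in> fball (K + 1)"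
        "g m - a \<in> fball (K + 1)" using ab unfolding J_def by auto
      obtain h where h: "h \<in> I" "\<forall>i. h i \<in> fball K" "\<forall>i<m. h i \<in> fball (K + 1)"
        "h m - b \<in> fball (K + 1)" using ab unfolding J_def by auto
      have "g m + h m - (a + b) \<in> fball (K + 1)"
        using fball_add[OF g(4) h(4)] by (simp add: algebra_simps)
      moreover have "(\<lambda>k. g k + h k) \<in> I"
        using I_add[OF g(1) h(1)] by (simp add: series_ring_simps)
      ultimately show ?thesis
        using g h by (intro J_I[of "\<lambda>k. g k + h k"]) (simp_all add: fball_add)
    qed
    show "b * a \<in> J" if ab: "a \<in> J" "0 \<le> v b" for a b
    proof -
      obtain g where g: "g \<in> I" "\<forall>i. g i \<in> fball K" "\<forall>i<m. g i \<in> fball (K + 1)"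
        "g m - a \<in> fball (K + 1)" using ab unfolding J_def by auto
      have b: "b \<in> \<O>" using ab by (simp add: fball_0)
      then have "const_series b \<in> carrier series_ring"
        by (auto simp: series_ring_simps const_series_def)
      from I_l_closed[OF g(1) this] have "(\<lambda>k. b * g k) \<in> I" by (simp add: const_series_mult)
      moreover have "b * g m - b * a \<in> fball (K + 1)"
        using fball_mult[OF b g(4)] by (simp add: algebra_simps)
      ultimately show ?thesis
        using g by (intro J_I[of "\<lambda>k. b * g k"]) (auto intro: fball_mult'[OF b])
    qed
    show "a * b \<in> J" if ab: "a \<in> J" "0 \<le> v b" for a b
    proof -
      obtain g where g: "g \<in> I" "\<forall>i. g i \<in> fball K" "\<forall>i<m. g i \<in> fball (K + 1)"
        "g m - a \<in> fball (K + 1)" using ab unfolding J_def by auto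
      have b: "b \<in> \<O>" using ab by (simp add: fball_0)
      \<comment> \<open>A constant factor on the right acts on the coefficient at \<open>m\<close>
        through \<open>\<sigma> ^^ m\<close>, so the preimage of \<open>b\<close> is the factor to
        use. It is integral because \<sigma> preserves values.\<close>
      obtain b' where b': "b = (\<sigma> ^^ m) b'"
        using bij_funpow_skew[OF skew] by (metis bij_pointE)
      then have b'_int: "b' \<in> \<O>" using b by (simp add: fball_funpow)
      then have "const_series b' \<in> carrier series_ring"
        by (auto simp: series_ring_simps const_series_def)
      from I_r_closed[OF g(1) this]
      have "g \<otimes>\<^bsub>series_ring\<^esub> const_series b' \<in> I" (is "?h \<in> I") .
      moreover have lead: "?h i - g i * (\<sigma> ^^ i) b' \<in> fball (K + 1)" for i
        using series_mult_const_leading[of g b' K i] carr g b'_int by auto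
      \<comment> \<open>With \<open>n\<close> equal to \<open>K\<close> or \<open>K + 1\<close> the
        bounds on \<open>g\<close> carry over to \<open>?h\<close>, since the correction lies in the
        ball of radius \<open>K + 1\<close>.\<close>
      moreover have "?h i \<in> fball n" if "g i \<in> fball n" "n \<le> K + 1" for i n
      proof -
        have "g i * (\<sigma> ^^ i) b' \<in> fball n"
          using that b'_int by (intro fball_mult'[of _ n _ 0]) (auto simp: fball_funpow)
        from fball_add[OF fball_mono[OF lead[of i] that(2)] this] show ?thesis by simp
      qed
      moreover have "?h m - a * b \<in> fball (K + 1)"
        using fball_add[OF lead[of m] fball_mult'[OF g(4) b order_refl[of "K + 1 + 0"], simplified]]
        by (simp add: b' algebra_simps)
      ultimately show ?thesis using g by (intro J_I[of ?h]) simp_all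
    qed
  qed
  then obtain u u' g where u: "u * u' = 1" "u' * u = 1" "u' \<in> fball (- K)"
    and g: "g \<in> I" "\<And>i. g i \<in> fball K" "\<And>i. i < m \<Longrightarrow> g i \<in> fball (K + 1)"
    "g m - u \<in> fball (K + 1)" unfolding J_def fball_def by auto
  have "u \<in> fball K" using fball_diff[OF g(2)[of m] fball_mono[OF g(4)]] by simp
  then obtain q where q: "q \<in> carrier series_ring"
    "\<And>j. (g \<otimes>\<^bsub>series_ring\<^esub> q) (m + j) = (if j = 0 then u else 0)"
    using weierstrass_division[of g K m u u'] carr[OF g(1)] g u ring_axioms by (auto simp: K_def)
  let ?w = "g \<otimes>\<^bsub>series_ring\<^esub> q"
  have "(1::'q) \<noteq> 0" using i0 by (metis mult_1 mult_zero_left)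
  then have "u \<noteq> 0" using u by auto
  then have "?w \<noteq> \<zero>\<^bsub>series_ring\<^esub>" using q(2)[of 0] by (auto simp: series_ring_simps(4))
  \<comment> \<open>Below \<open>m\<close> the coefficients of \<open>?w\<close> are left
    uncontrolled: vanishing beyond \<open>m\<close> makes it a polynomial, and the coefficient
    \<open>u\<close> at \<open>m\<close> makes it nonzero.\<close>
  moreover have "?w i = 0" if "m < i" for i using q(2)[of "i - m"] that by simp
  then have "{i. ?w i \<noteq> 0} \<subseteq> {..m}" by (auto simp: not_less[symmetric])
  then have "finite {i. ?w i \<noteq> 0}" by (rule finite_subset) simp
  ultimately show ?thesis using I_r_closed[OF g(1) q(1)] by blast
qed

end

subsection \<open>Evaluation of skew polynomials\<close>

lemma ring_of_type_algebra_simps: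
  "carrier (ring_of_type_algebra :: 'q::ring_1 ring) = UNIV"
  "r \<otimes>\<^bsub>ring_of_type_algebra\<^esub> s = r * s"
  "r \<oplus>\<^bsub>ring_of_type_algebra\<^esub> s = r + s"
  "\<one>\<^bsub>ring_of_type_algebra\<^esub> = 1"
  "\<zero>\<^bsub>ring_of_type_algebra\<^esub> = 0"
  by (simp_all add: ring_of_type_algebra_def)

lemma ring_ring_of_type_algebra: "ring (ring_of_type_algebra :: 'q::ring_1 ring)"
proof -
  have "\<exists>y. y + x = 0 \<and> x + y = 0" for x :: 'q by (intro exI[of _ "- x"]) simp
  then show ?thesis
    by unfold_locales (auto simp: ring_of_type_algebra_simps Units_def algebra_simps)
qed

definition skew_indet :: "nat \<Rightarrow> 'q::ring_1"
  where "skew_indet i = (if i = 1 then 1 else 0)"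

text \<open>The coefficients of \<open>x f\<close>, read off from the rule for \<open>x r\<close>.
  It is kept apart from both ring structures because it describes left multiplication by x among
  polynomials as well as among power series.\<close>

definition indet_mult :: "('q::ring_1 \<Rightarrow> 'q) \<Rightarrow> ('q \<Rightarrow> 'q) \<Rightarrow> (nat \<Rightarrow> 'q) \<Rightarrow> nat \<Rightarrow> 'q"
  where "indet_mult \<sigma> \<delta> f k = (if k = 0 then 0 else \<sigma> (f (k - 1))) + \<delta> (f k)"

context
  fixes \<sigma> \<delta> :: "'q::ring_1 \<Rightarrow> 'q"
  assumes skew: "skew_derivation \<sigma> \<delta>"
begin

lemma skew_mult_term_const: "skew_mult_term \<sigma> \<delta> (const_series r) f k 0 = r * f k"
proof -
  have "skew_mult_term \<sigma> \<delta> (const_series r) f k 0 = (\<Sum>j\<le>k. if j = k then r * f k else 0)"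
    unfolding skew_mult_term_def const_series_def by (rule sum.cong) auto
  then show ?thesis by simp
qed

text \<open>Stated for a partial sum of \<open>skew_mult_term\<close>, because products with a
  polynomial as left factor reduce to such sums in both rings.\<close>

lemma skew_mult_term_indet_left:
  "(\<Sum>i<2. skew_mult_term \<sigma> \<delta> skew_indet f k i) = indet_mult \<sigma> \<delta> f k"
proof -
  have "(\<Sum>i<2. skew_mult_term \<sigma> \<delta> skew_indet f k i) = (\<Sum>j\<le>k. skew_coeff \<sigma> \<delta> 1 (k - j) (f j))"
    by (simp add: skew_mult_term_def skew_indet_def numeral_2_eq_2)
  also have "\<dots> = (\<Sum>j\<le>k. (if Suc j = k then \<sigma> (f j) else 0) + (if j = k then \<delta> (f k) else 0))"
    by (rule sum.cong) (auto simp: skew_zero[OF skew])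
  also have "\<dots> = indet_mult \<sigma> \<delta> f k"
    by (cases k) (simp_all add: sum.distrib indet_mult_def)
  finally show ?thesis .
qed

lemma skew_mult_term_indet_right:
  assumes "\<And>i. N \<le> i \<Longrightarrow> f i = 0"
  shows "(\<Sum>i<N. skew_mult_term \<sigma> \<delta> f skew_indet k i) = (if k = 0 then 0 else f (k - 1))"
proof -
  have "skew_mult_term \<sigma> \<delta> f skew_indet k i = (if k = Suc i then f i else 0)" for i
  proof -
    have "skew_mult_term \<sigma> \<delta> f skew_indet k i = (\<Sum>j\<le>k. if j = 1 then f i * (if k - 1 = i then 1 else 0) else 0)"
      unfolding skew_mult_term_def skew_indet_def
      by (rule sum.cong) (auto simp: skew_coeff_zero[OF skew] skew_coeff_one[OF skew])
    then show ?thesis by (cases k) auto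
  qed
  then show ?thesis using assms by (cases k) auto
qed

abbreviation (input) "skew_polys \<equiv> skew_poly_ring (UNIV :: 'q set) \<sigma> \<delta>"

lemma poly_ring_simps:
  "carrier skew_polys = {f. finite {i. f i \<noteq> 0}}"
  "f \<oplus>\<^bsub>skew_polys\<^esub> g = (\<lambda>k. f k + g k)"
  "\<zero>\<^bsub>skew_polys\<^esub> = (\<lambda>_. 0)"
  "\<one>\<^bsub>skew_polys\<^esub> = const_series 1"
  by (simp_all add: skew_poly_ring_def)

lemma poly_ring_carrier_iff: "f \<in> carrier skew_polys \<longleftrightarrow> (\<exists>N. \<forall>i\<ge>N. f i = 0)"
proof
  assume "f \<in> carrier skew_polys"
  then obtain N where "\<forall>i\<in>{i. f i \<noteq> 0}. i < N"
    by (auto simp: poly_ring_simps finite_nat_set_iff_bounded)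
  then show "\<exists>N. \<forall>i\<ge>N. f i = 0" by (intro exI[of _ N]) (auto simp: not_less[symmetric])
next
  assume "\<exists>N. \<forall>i\<ge>N. f i = 0"
  then obtain N where "\<forall>i\<ge>N. f i = 0" ..
  then have "{i. f i \<noteq> 0} \<subseteq> {..<N}" by (auto simp: not_less[symmetric])
  then show "f \<in> carrier skew_polys" by (auto simp: poly_ring_simps intro: finite_subset)
qed

lemma poly_mult:
  assumes "\<And>i. N \<le> i \<Longrightarrow> f i = 0"
  shows "f \<otimes>\<^bsub>skew_polys\<^esub> g = (\<lambda>k. \<Sum>i<N. skew_mult_term \<sigma> \<delta> f g k i)"
proof -
  have "{i. f i \<noteq> 0} \<subseteq> {..<N}" using assms by (auto simp: not_less[symmetric])
  then show ?thesis
    by (auto simp: skew_poly_ring_def skew_mult_term_def fun_eq_iff intro!: sum.mono_neutral_left)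
qed

lemma poly_const_mult: "const_series r \<otimes>\<^bsub>skew_polys\<^esub> f = (\<lambda>k. r * f k)"
  using poly_mult[of 1 "const_series r" f] skew_mult_term_const by (simp add: const_series_def)

lemma poly_indet_mult: "skew_indet \<otimes>\<^bsub>skew_polys\<^esub> f = indet_mult \<sigma> \<delta> f"
  using poly_mult[of 2 skew_indet f] skew_mult_term_indet_left by (simp add: skew_indet_def)

lemma poly_mult_indet:
  assumes "\<And>i. N \<le> i \<Longrightarrow> f i = 0"
  shows "f \<otimes>\<^bsub>skew_polys\<^esub> skew_indet = (\<lambda>k. if k = 0 then 0 else f (k - 1))"
  using skew_mult_term_indet_right[of N f] assms by (simp add: poly_mult[OF assms])

end

text \<open>The recursion follows \<open>f = f 0 + f' x\<close> with \<open>f'\<close> the shifted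
  sequence, coefficients standing on the left. Proofs become inductions on \<open>N\<close> in which
  no powers of x appear.\<close>

primrec skew_horner ::
    "('b, 'm) ring_scheme \<Rightarrow> ('q \<Rightarrow> 'b) \<Rightarrow> 'b \<Rightarrow> nat \<Rightarrow> (nat \<Rightarrow> 'q) \<Rightarrow> 'b"
  where
    "skew_horner T \<theta> x 0 f = \<zero>\<^bsub>T\<^esub>"
  | "skew_horner T \<theta> x (Suc N) f =
       \<theta> (f 0) \<oplus>\<^bsub>T\<^esub> skew_horner T \<theta> x N (\<lambda>i. f (Suc i)) \<otimes>\<^bsub>T\<^esub> x"

text \<open>
  Any \<open>N\<close> beyond the degree gives the same value of the Horner scheme; on power series that are
  not polynomials the value is junk.
\<close>
definition skew_eval :: "('b, 'm) ring_scheme \<Rightarrow> ('q::zero \<Rightarrow> 'b) \<Rightarrow> 'b \<Rightarrow> (nat \<Rightarrow> 'q) \<Rightarrow> 'b"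
  where "skew_eval T \<theta> x f = skew_horner T \<theta> x (LEAST N. \<forall>i\<ge>N. f i = 0) f"

context
  fixes \<sigma> \<delta> :: "'q::ring_1 \<Rightarrow> 'q" and T (structure) and \<theta> :: "'q \<Rightarrow> 'b" and x :: 'b
  assumes skew: "skew_derivation \<sigma> \<delta>"
    and ring_T: "ring T"
    and \<theta>: "\<theta> \<in> ring_hom ring_of_type_algebra T"
    and x: "x \<in> carrier T"
    and comm: "\<And>q. x \<otimes> \<theta> q = \<theta> (\<sigma> q) \<otimes> x \<oplus> \<theta> (\<delta> q)"
begin

interpretation T: ring T by (fact ring_T)

lemma theta_simps:
  "\<theta> r \<in> carrier T" "\<theta> (r * s) = \<theta> r \<otimes> \<theta> s" "\<theta> (r + s) = \<theta> r \<oplus> \<theta> s" "\<theta> 1 = \<one>" "\<theta> 0 = \<zero>"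
proof -
  show *: "\<theta> r \<in> carrier T" "\<theta> (r * s) = \<theta> r \<otimes> \<theta> s" "\<theta> (r + s) = \<theta> r \<oplus> \<theta> s" "\<theta> 1 = \<one>" for r s
    using ring_hom_closed[OF \<theta>, of r] ring_hom_mult[OF \<theta>, of r s] ring_hom_add[OF \<theta>, of r s]
      ring_hom_one[OF \<theta>] by (auto simp: ring_of_type_algebra_simps)
  show "\<theta> 0 = \<zero>" using *(3)[of 0 0] *(1)[of 0] by (simp add: T.add.l_cancel_one')
qed

lemma skew_horner_closed: "skew_horner T \<theta> x N f \<in> carrier T"
  by (induction N arbitrary: f) (auto simp: theta_simps x)

lemma skew_horner_add:
  "skew_horner T \<theta> x N (\<lambda>i. f i + g i) = skew_horner T \<theta> x N f \<oplus> skew_horner T \<theta> x N g"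
  by (induction N arbitrary: f g)
    (auto simp: theta_simps x skew_horner_closed T.l_distr T.a_ac)

lemma skew_horner_zero: "(\<And>i. f i = 0) \<Longrightarrow> skew_horner T \<theta> x N f = \<zero>"
  by (induction N arbitrary: f) (auto simp: theta_simps x)

lemma skew_horner_stable:
  "(\<And>i. N \<le> i \<Longrightarrow> f i = 0) \<Longrightarrow> N \<le> M \<Longrightarrow> skew_horner T \<theta> x M f = skew_horner T \<theta> x N f"
proof (induction N arbitrary: f M)
  case 0
  then show ?case by (simp add: skew_horner_zero)
next
  case (Suc N)
  from Suc.prems(2) obtain M' where M: "M = Suc M'" "N \<le> M'" by (cases M) auto
  show ?case using Suc.IH[of "\<lambda>i. f (Suc i)" M'] Suc.prems(1) M by simp
qed

lemma skew_horner_const: "skew_horner T \<theta> x N (\<lambda>i. r * f i) = \<theta> r \<otimes> skew_horner T \<theta> x N f"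
  by (induction N arbitrary: f)
    (auto simp: theta_simps x skew_horner_closed T.r_distr T.m_assoc)

lemma skew_horner_const_series: "skew_horner T \<theta> x (Suc N) (const_series r) = \<theta> r"
  by (simp add: const_series_def skew_horner_zero theta_simps x)

text \<open>This is where the commutation rule \<open>comm\<close> enters. The induction rests on
  \<open>x f = \<delta>(f 0) + (\<sigma>(f 0) + x f') x\<close>, with \<open>f'\<close> the shift of
  \<open>f\<close>.\<close>

lemma skew_horner_indet_mult:
  "(\<And>i. N \<le> i \<Longrightarrow> f i = 0) \<Longrightarrow>
    skew_horner T \<theta> x (Suc N) (indet_mult \<sigma> \<delta> f) = x \<otimes> skew_horner T \<theta> x N f"
proof (induction N arbitrary: f)
  case 0
  then have "indet_mult \<sigma> \<delta> f i = 0" for i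
    by (simp add: indet_mult_def skew_zero[OF skew])
  then show ?case by (simp only: skew_horner_zero) (simp add: x)
next
  case (Suc N)
  let ?f' = "\<lambda>i. f (Suc i)"
  let ?h = "skew_horner T \<theta> x N ?f'"
  have "(\<lambda>i. indet_mult \<sigma> \<delta> f (Suc i)) = (\<lambda>i. const_series (\<sigma> (f 0)) i + indet_mult \<sigma> \<delta> ?f' i)"
    by (auto simp: fun_eq_iff indet_mult_def const_series_def)
  then have "skew_horner T \<theta> x (Suc (Suc N)) (indet_mult \<sigma> \<delta> f) =
      \<theta> (\<delta> (f 0)) \<oplus> (\<theta> (\<sigma> (f 0)) \<oplus> x \<otimes> ?h) \<otimes> x"
    using Suc.IH[of ?f'] Suc.prems
    by (subst skew_horner.simps)
      (simp only: skew_horner_add skew_horner_const_series, simp add: indet_mult_def)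
  also have "\<dots> = (\<theta> (\<sigma> (f 0)) \<otimes> x \<oplus> \<theta> (\<delta> (f 0))) \<oplus> x \<otimes> (?h \<otimes> x)"
    by (simp add: theta_simps x skew_horner_closed T.l_distr T.m_assoc T.a_ac)
  also have "\<dots> = x \<otimes> skew_horner T \<theta> x (Suc N) f"
    by (simp add: comm[symmetric] theta_simps x skew_horner_closed T.r_distr)
  finally show ?case .
qed

lemma skew_eval_eq:
  assumes "\<And>i. N \<le> i \<Longrightarrow> f i = 0"
  shows "skew_eval T \<theta> x f = skew_horner T \<theta> x N f"
proof -
  let ?P = "\<lambda>N. \<forall>i\<ge>N. f i = 0"
  have "?P N" using assms by blast
  then have least: "?P (LEAST N. ?P N)" and le: "(LEAST N. ?P N) \<le> N"
    by (rule LeastI, rule Least_le)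
  have "skew_horner T \<theta> x N f = skew_horner T \<theta> x (LEAST N. ?P N) f"
    by (rule skew_horner_stable[OF _ le]) (rule least[rule_format])
  then show ?thesis unfolding skew_eval_def by (rule sym)
qed

lemma skew_eval_const_series: "skew_eval T \<theta> x (const_series r) = \<theta> r"
  by (subst skew_eval_eq[of "Suc 0"])
    (simp_all only: skew_horner_const_series, simp add: const_series_def)

lemma skew_eval_shift:
  assumes "\<And>i. Suc N \<le> i \<Longrightarrow> f i = 0"
  shows "skew_eval T \<theta> x f = \<theta> (f 0) \<oplus> skew_eval T \<theta> x (\<lambda>i. f (Suc i)) \<otimes> x"
  using skew_eval_eq[of "Suc N" f] skew_eval_eq[of N "\<lambda>i. f (Suc i)"] assms by simp

lemma skew_eval_closed: "skew_eval T \<theta> x f \<in> carrier T"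
  unfolding skew_eval_def by (rule skew_horner_closed)

lemma skew_eval_add:
  assumes "f \<in> carrier (skew_poly_ring UNIV \<sigma> \<delta>)" "g \<in> carrier (skew_poly_ring UNIV \<sigma> \<delta>)"
  shows "skew_eval T \<theta> x (\<lambda>i. f i + g i) = skew_eval T \<theta> x f \<oplus> skew_eval T \<theta> x g"
proof -
  obtain N where "\<forall>i\<ge>N. f i = 0" using assms(1) poly_ring_carrier_iff[OF skew] by blast
  moreover obtain M where "\<forall>i\<ge>M. g i = 0" using assms(2) poly_ring_carrier_iff[OF skew] by blast
  ultimately have "\<forall>i\<ge>max M N. f i = 0 \<and> g i = 0" by simp
  then show ?thesis
    using skew_eval_eq[of "max M N" f] skew_eval_eq[of "max M N" g]
      skew_eval_eq[of "max M N" "\<lambda>i. f i + g i"] by (simp add: skew_horner_add)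
qed

lemma skew_eval_const_mult:
  assumes "f \<in> carrier (skew_poly_ring UNIV \<sigma> \<delta>)"
  shows "skew_eval T \<theta> x (\<lambda>i. r * f i) = \<theta> r \<otimes> skew_eval T \<theta> x f"
proof -
  obtain N where "\<forall>i\<ge>N. f i = 0" using assms poly_ring_carrier_iff[OF skew] by blast
  then show ?thesis
    using skew_eval_eq[of N f] skew_eval_eq[of N "\<lambda>i. r * f i"] by (simp add: skew_horner_const)
qed

lemma skew_eval_indet_mult:
  assumes "f \<in> carrier (skew_poly_ring UNIV \<sigma> \<delta>)"
  shows "skew_eval T \<theta> x (indet_mult \<sigma> \<delta> f) = x \<otimes> skew_eval T \<theta> x f"
proof -
  obtain N where N: "\<And>i. N \<le> i \<Longrightarrow> f i = 0" using assms poly_ring_carrier_iff[OF skew] by blast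
  then have "\<And>i. Suc N \<le> i \<Longrightarrow> indet_mult \<sigma> \<delta> f i = 0"
    by (simp add: indet_mult_def skew_zero[OF skew])
  then show ?thesis
    using skew_eval_eq[of "Suc N" "indet_mult \<sigma> \<delta> f"] skew_eval_eq[of N f] N
      skew_horner_indet_mult[of N f] by simp
qed

text \<open>From \<open>f = c + f' x\<close> follows \<open>f g = c g + f' (x g)\<close>, and
  \<open>f'\<close> is shorter than \<open>f\<close>. The right factor changes from \<open>g\<close>
  to \<open>x g\<close>, so the induction has to range over all \<open>g\<close>.\<close>

lemma skew_eval_mult:
  assumes ring: "ring (skew_poly_ring UNIV \<sigma> \<delta>)" and g: "g \<in> carrier (skew_poly_ring UNIV \<sigma> \<delta>)"
  shows "(\<And>i. N \<le> i \<Longrightarrow> f i = 0) \<Longrightarrow>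
    skew_eval T \<theta> x (f \<otimes>\<^bsub>skew_poly_ring UNIV \<sigma> \<delta>\<^esub> g) = skew_eval T \<theta> x f \<otimes> skew_eval T \<theta> x g"
  using g
proof (induction N arbitrary: f g)
  case 0
  interpret P: ring "skew_poly_ring UNIV \<sigma> \<delta>" by fact
  have f: "f = \<zero>\<^bsub>skew_poly_ring UNIV \<sigma> \<delta>\<^esub>" using 0 by (auto simp: poly_ring_simps[OF skew])
  have "skew_eval T \<theta> x (\<zero>\<^bsub>skew_poly_ring UNIV \<sigma> \<delta>\<^esub>) = \<zero>"
    using skew_eval_eq[of 0 "\<lambda>_. 0"] by (simp add: poly_ring_simps[OF skew])
  then show ?case using P.l_null[OF 0(2)] by (simp add: f skew_eval_closed)
next
  case (Suc N)
  interpret P: ring "skew_poly_ring UNIV \<sigma> \<delta>" by fact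
  let ?P = "skew_poly_ring (UNIV :: 'q set) \<sigma> \<delta>" and ?ev = "skew_eval T \<theta> x"
  let ?c = "const_series (f 0)" and ?f' = "\<lambda>i. f (Suc i)"
  have f': "?f' i = 0" if "N \<le> i" for i using Suc.prems(1) that by simp
  have carr: "?f' \<in> carrier ?P" "?c \<in> carrier ?P" "skew_indet \<in> carrier ?P"
    unfolding poly_ring_carrier_iff[OF skew]
    using f' by (auto simp: const_series_def skew_indet_def intro: exI[of _ "1::nat"] exI[of _ "2::nat"])
  have f: "f = ?c \<oplus>\<^bsub>?P\<^esub> ?f' \<otimes>\<^bsub>?P\<^esub> skew_indet"
    using poly_mult_indet[OF skew, of N ?f'] f'
    by (auto simp: poly_ring_simps[OF skew] const_series_def fun_eq_iff)
  have ig: "skew_indet \<otimes>\<^bsub>?P\<^esub> g \<in> carrier ?P" using carr Suc.prems by simp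
  have "f \<otimes>\<^bsub>?P\<^esub> g = ?c \<otimes>\<^bsub>?P\<^esub> g \<oplus>\<^bsub>?P\<^esub> ?f' \<otimes>\<^bsub>?P\<^esub> (skew_indet \<otimes>\<^bsub>?P\<^esub> g)"
    using carr Suc.prems by (subst f) (simp add: P.l_distr P.m_assoc)
  then have "?ev (f \<otimes>\<^bsub>?P\<^esub> g) = ?ev (?c \<otimes>\<^bsub>?P\<^esub> g) \<oplus> ?ev (?f' \<otimes>\<^bsub>?P\<^esub> (skew_indet \<otimes>\<^bsub>?P\<^esub> g))"
    using skew_eval_add[OF P.m_closed[OF carr(2) Suc.prems(2)] P.m_closed[OF carr(1) ig]]
    by (simp add: poly_ring_simps(2)[OF skew])
  also have "?ev (?f' \<otimes>\<^bsub>?P\<^esub> (skew_indet \<otimes>\<^bsub>?P\<^esub> g)) = ?ev ?f' \<otimes> (x \<otimes> ?ev g)"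
    using Suc.IH[of ?f' "skew_indet \<otimes>\<^bsub>?P\<^esub> g"] f' ig Suc.prems(2)
    by (simp add: poly_indet_mult[OF skew] skew_eval_indet_mult)
  also have "?ev (?c \<otimes>\<^bsub>?P\<^esub> g) = \<theta> (f 0) \<otimes> ?ev g"
    using Suc.prems(2) by (simp add: poly_const_mult[OF skew] skew_eval_const_mult)
  finally show ?case
    using skew_eval_shift[of N f] Suc.prems(1)
    by (simp add: theta_simps x skew_eval_closed T.l_distr T.m_assoc)
qed

lemma skew_eval_ring_hom:
  assumes "ring (skew_poly_ring UNIV \<sigma> \<delta>)"
  shows "skew_eval T \<theta> x \<in> ring_hom (skew_poly_ring UNIV \<sigma> \<delta>) T"
proof (rule ring_hom_memI)
  fix f g assume "f \<in> carrier (skew_poly_ring UNIV \<sigma> \<delta>)" "g \<in> carrier (skew_poly_ring UNIV \<sigma> \<delta>)"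
  then show "skew_eval T \<theta> x (f \<otimes>\<^bsub>skew_poly_ring UNIV \<sigma> \<delta>\<^esub> g) = skew_eval T \<theta> x f \<otimes> skew_eval T \<theta> x g"
    using skew_eval_mult[OF assms] by (meson poly_ring_carrier_iff[OF skew])
qed (simp_all add: skew_eval_closed skew_eval_add poly_ring_simps(2,4)[OF skew]
       skew_eval_const_series theta_simps)

end

subsection \<open>Simplicity of the localisation\<close>

text \<open>The difference of the two generators is a defining relation, so they lie in the same
  coset. This is what identifies the maps that \<O> receives from both tensor factors.\<close>

lemma pure_tensor_balanced:
  assumes "ring A" "ring B" and \<phi>: "\<phi> ` K \<subseteq> carrier A" and \<psi>: "\<psi> ` K \<subseteq> carrier B"
    and a: "a \<in> carrier A" and b: "b \<in> carrier B" and r: "r \<in> K"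
  shows "pure_tensor A B K \<phi> \<psi> (a \<otimes>\<^bsub>A\<^esub> \<phi> r) b = pure_tensor A B K \<phi> \<psi> a (\<psi> r \<otimes>\<^bsub>B\<^esub> b)"
proof -
  interpret A: ring A by fact
  interpret B: ring B by fact
  let ?G = "free_Abelian_group (carrier A \<times> carrier B)" and ?H = "tensor_relations A B K \<phi> \<psi>"
  interpret G: group ?G by simp
  have "subgroup ?H ?G"
    unfolding tensor_relations_def
    using \<phi> \<psi> by (intro G.generate_is_subgroup subsetI)
      (auto simp: image_subset_iff dest!: subsetD[OF keys_diff])
  moreover have "frag_of (a \<otimes>\<^bsub>A\<^esub> \<phi> r, b) - frag_of (a, \<psi> r \<otimes>\<^bsub>B\<^esub> b) \<in> ?H"
    unfolding tensor_relations_def using a b r by (blast intro: generate.incl)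
  then have "frag_of (a \<otimes>\<^bsub>A\<^esub> \<phi> r, b) \<in> ?H #>\<^bsub>?G\<^esub> frag_of (a, \<psi> r \<otimes>\<^bsub>B\<^esub> b)"
    unfolding r_coset_def by force
  moreover have "frag_of (a, \<psi> r \<otimes>\<^bsub>B\<^esub> b) \<in> carrier ?G"
    using a b r \<psi> by (auto simp: image_subset_iff)
  ultimately show ?thesis
    unfolding pure_tensor_def using G.repr_independence by metis
qed

section \<open>Contraction of ideals of the localisation\<close>

context complete_filtered_skew_ring
begin

lemma series_mult_poly:
  assumes "\<And>i. N \<le> i \<Longrightarrow> f i = 0"
  shows "f \<otimes>\<^bsub>series_ring\<^esub> g = (\<lambda>k. \<Sum>i<N. skew_mult_term \<sigma> \<delta> f g k i)"
  unfolding series_ring_simps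
  by (intro ext filt_suminf_finite) (simp add: skew_mult_term_def assms)

text \<open>If \<open>q\<close> has negative value \<open>k\<close>, an invertible \<open>u'\<close>
  of value at least \<open>- k\<close> is a left denominator. It comes from
  \<open>unit_of_value\<close> with the whole ring as \<open>J\<close>.\<close>

lemma exists_denominator: "\<exists>s\<in>\<O>. \<exists>s'. s' * s = 1 \<and> s * q \<in> \<O>"
proof (cases "q \<in> \<O>")
  case True
  then show ?thesis using fball_one by (intro bexI[of _ 1] exI[of _ 1]) auto
next
  case False
  then have "q \<noteq> 0" by auto
  then obtain k where k: "v q = ereal (of_int k)" using v_integral by blast
  have "k < 0" using False k by (simp add: fball_0)
  obtain u u' where u: "u * u' = 1" "ereal (of_int (- k)) \<le> v u'"
    using unit_of_value[OF k, of UNIV] by auto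
  have "u' \<in> fball (- k)" "q \<in> fball k" using u k by (auto simp: fball_def)
  then have "u' * q \<in> \<O>" "u' \<in> \<O>"
    using \<open>k < 0\<close> by (auto intro: fball_mult' fball_mono)
  with u show ?thesis by blast
qed

lemma series_indet_commutes:
  "skew_indet \<otimes>\<^bsub>series_ring\<^esub> const_series r =
    const_series (\<sigma> r) \<otimes>\<^bsub>series_ring\<^esub> skew_indet \<oplus>\<^bsub>series_ring\<^esub> const_series (\<delta> r)"
proof -
  have "skew_indet \<otimes>\<^bsub>series_ring\<^esub> const_series r = indet_mult \<sigma> \<delta> (const_series r)"
    using series_mult_poly[of 2 skew_indet] skew_mult_term_indet_left[OF skew]
    by (simp add: skew_indet_def)
  also have "\<dots> = (\<lambda>k. \<sigma> r * skew_indet k + const_series (\<delta> r) k)"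
    by (auto simp: indet_mult_def const_series_def skew_indet_def skew_zero[OF skew])
  finally show ?thesis by (simp add: const_series_mult series_ring_simps(3))
qed

text \<open>Any localisation that receives \<open>Q\<close> compatibly with \<O> will do; the tensor
  product appears only in the corollary. Two maps into \<open>T\<close> have to be matched:
  \<open>j\<close>, defined on series over \<O>, and evaluation, defined on polynomials over all of
  \<open>Q\<close>.\<close>

theorem simple_localisation:
  assumes simple: "simple_ring (skew_poly_ring UNIV \<sigma> \<delta>)"
    and loc: "is_localisation series_ring S T j"
    and \<theta>: "\<theta> \<in> ring_hom ring_of_type_algebra T"
    and agree: "\<And>r. r \<in> \<O> \<Longrightarrow> \<theta> r = j (const_series r)"
    and S: "\<zero>\<^bsub>series_ring\<^esub> \<notin> S"
  shows "simple_ring T"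
proof -
  let ?P = "skew_poly_ring (UNIV :: 'q set) \<sigma> \<delta>"
  have "ring series_ring" "ring T" and ring_P: "ring ?P"
    using loc simple by (auto simp: is_localisation_def simple_ring_def)
  interpret R: ring series_ring by fact
  interpret T: ring T by fact
  have j: "j \<in> ring_hom series_ring T" and Units: "\<And>s. s \<in> S \<Longrightarrow> j s \<in> Units T"
    and frac: "\<And>y. y \<in> carrier T \<Longrightarrow>
      \<exists>s\<in>S. \<exists>r\<in>carrier series_ring. y = inv\<^bsub>T\<^esub> (j s) \<otimes>\<^bsub>T\<^esub> j r"
    and ker: "\<And>r. r \<in> carrier series_ring \<Longrightarrow>
      j r = \<zero>\<^bsub>T\<^esub> \<longleftrightarrow> (\<exists>s\<in>S. s \<otimes>\<^bsub>series_ring\<^esub> r = \<zero>\<^bsub>series_ring\<^esub>)"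
    and S_carr: "S \<subseteq> carrier series_ring"
    using loc by (auto simp: is_localisation_def)
  interpret j: ring_hom_ring series_ring T j
    using ring_hom_ringI2[OF \<open>ring series_ring\<close> \<open>ring T\<close> j] .
  have const_carr: "const_series r \<in> carrier series_ring" if "r \<in> \<O>" for r
    using that by (auto simp: series_ring_simps const_series_def)
  have indet_carr: "skew_indet \<in> carrier series_ring"
    using fball_one by (auto simp: series_ring_simps skew_indet_def)
  let ?x = "j skew_indet"
  have x: "?x \<in> carrier T" using indet_carr by simp
  have \<theta>_carr: "\<theta> r \<in> carrier T" for r
    using ring_hom_closed[OF \<theta>] by (simp add: ring_of_type_algebra_simps)
  have \<theta>_mult: "\<theta> (r * s) = \<theta> r \<otimes>\<^bsub>T\<^esub> \<theta> s" and \<theta>_add: "\<theta> (r + s) = \<theta> r \<oplus>\<^bsub>T\<^esub> \<theta> s" for r s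
    using ring_hom_mult[OF \<theta>, of r s] ring_hom_add[OF \<theta>, of r s]
    by (auto simp: ring_of_type_algebra_simps)
  have \<theta>_one: "\<theta> 1 = \<one>\<^bsub>T\<^esub>" using ring_hom_one[OF \<theta>] by (simp add: ring_of_type_algebra_simps)
  have comm_int: "?x \<otimes>\<^bsub>T\<^esub> \<theta> r = \<theta> (\<sigma> r) \<otimes>\<^bsub>T\<^esub> ?x \<oplus>\<^bsub>T\<^esub> \<theta> (\<delta> r)" if r: "r \<in> \<O>" for r
  proof -
    have "\<sigma> r \<in> \<O>" "\<delta> r \<in> \<O>" using r fball_mono[OF fball_delta[OF r]] by (auto simp: fball_sigma)
    then show ?thesis
      using arg_cong[OF series_indet_commutes[of r], of j] const_carr indet_carr r
      by (simp add: agree)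
  qed
  \<comment> \<open>Outside \<O> the power series ring does not supply the rule. Clear a left
    denominator \<open>s\<close> of \<open>q\<close>, expand the product of x with
    \<open>\<theta> s\<close> and \<open>\<theta> q\<close> once by the rule for \<open>s\<close>
    and once by the rule for \<open>s * q\<close>, and cancel \<open>\<theta> (\<sigma> s)\<close>,
    which has a left inverse.\<close>
  have comm: "?x \<otimes>\<^bsub>T\<^esub> \<theta> q = \<theta> (\<sigma> q) \<otimes>\<^bsub>T\<^esub> ?x \<oplus>\<^bsub>T\<^esub> \<theta> (\<delta> q)" for q
  proof -
    obtain s s' where s: "s \<in> \<O>" "s' * s = 1" "s * q \<in> \<O>" using exists_denominator by blast
    let ?a = "?x \<otimes>\<^bsub>T\<^esub> \<theta> q" and ?b = "\<theta> (\<sigma> q) \<otimes>\<^bsub>T\<^esub> ?x \<oplus>\<^bsub>T\<^esub> \<theta> (\<delta> q)"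
    have carr: "?a \<in> carrier T" "?b \<in> carrier T" using x \<theta>_carr by simp_all
    have "\<theta> (\<sigma> s) \<otimes>\<^bsub>T\<^esub> ?a \<oplus>\<^bsub>T\<^esub> \<theta> (\<delta> s) \<otimes>\<^bsub>T\<^esub> \<theta> q = (?x \<otimes>\<^bsub>T\<^esub> \<theta> s) \<otimes>\<^bsub>T\<^esub> \<theta> q"
      unfolding comm_int[OF s(1)] using x \<theta>_carr by (simp add: T.l_distr T.m_assoc)
    also have "\<dots> = ?x \<otimes>\<^bsub>T\<^esub> \<theta> (s * q)" using x \<theta>_carr by (simp add: \<theta>_mult T.m_assoc)
    also have "\<dots> = \<theta> (\<sigma> s) \<otimes>\<^bsub>T\<^esub> ?b \<oplus>\<^bsub>T\<^esub> \<theta> (\<delta> s) \<otimes>\<^bsub>T\<^esub> \<theta> q"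
      unfolding comm_int[OF s(3)]
      unfolding skew_derivationD(3,6)[OF skew] \<theta>_mult \<theta>_add
      using x \<theta>_carr by (simp add: T.r_distr T.m_assoc T.a_ac)
    finally have *: "\<theta> (\<sigma> s) \<otimes>\<^bsub>T\<^esub> ?a = \<theta> (\<sigma> s) \<otimes>\<^bsub>T\<^esub> ?b"
      using carr \<theta>_carr by (simp only: T.add.r_cancel T.m_closed)
    have "\<theta> (\<sigma> s') \<otimes>\<^bsub>T\<^esub> \<theta> (\<sigma> s) = \<one>\<^bsub>T\<^esub>"
      using s(2) by (simp flip: \<theta>_mult skew_derivationD(3)[OF skew])
        (simp add: skew_derivationD(4)[OF skew] \<theta>_one)
    then have inv: "\<theta> (\<sigma> s') \<otimes>\<^bsub>T\<^esub> (\<theta> (\<sigma> s) \<otimes>\<^bsub>T\<^esub> y) = y" if "y \<in> carrier T" for y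
      using that \<theta>_carr by (simp flip: T.m_assoc)
    show ?thesis using arg_cong[OF *, of "\<lambda>y. \<theta> (\<sigma> s') \<otimes>\<^bsub>T\<^esub> y"] by (simp only: inv carr)
  qed
  note ctx = skew \<open>ring T\<close> \<theta> x comm
  let ?ev = "skew_eval T \<theta> ?x"
  interpret ev: ring_hom_ring ?P T ?ev
    using ring_hom_ringI2[OF ring_P \<open>ring T\<close> skew_eval_ring_hom[OF ctx ring_P]] .
  \<comment> \<open>Both maps are defined on polynomials over \<O> and agree there, by splitting off
    the constant term. So a polynomial found in the contraction along \<open>j\<close> also lies in
    the contraction along evaluation.\<close>
  have ev_eq_j: "(\<And>i. w i \<in> \<O>) \<Longrightarrow> (\<And>i. N \<le> i \<Longrightarrow> w i = 0) \<Longrightarrow> ?ev w = j w" for w N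
  proof (induction N arbitrary: w)
    case 0
    then have "w = \<zero>\<^bsub>series_ring\<^esub>" "w = \<zero>\<^bsub>?P\<^esub>"
      by (auto simp: series_ring_simps poly_ring_simps[OF skew])
    then show ?case using j.hom_zero ev.hom_zero by metis
  next
    case (Suc N)
    let ?w' = "\<lambda>i. w (Suc i)"
    have w': "?w' i = 0" if "N \<le> i" for i using Suc.prems(2) that by simp
    have "w = const_series (w 0) \<oplus>\<^bsub>series_ring\<^esub> ?w' \<otimes>\<^bsub>series_ring\<^esub> skew_indet"
      using series_mult_poly[of N ?w' skew_indet] w' skew_mult_term_indet_right[OF skew, of N ?w']
      by (auto simp: series_ring_simps(3) const_series_def fun_eq_iff)
    moreover have "?w' \<in> carrier series_ring" using Suc.prems by (simp add: series_ring_simps)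
    ultimately have "j w = \<theta> (w 0) \<oplus>\<^bsub>T\<^esub> j ?w' \<otimes>\<^bsub>T\<^esub> ?x"
      using const_carr[of "w 0"] indet_carr Suc.prems(1) agree[of "w 0"]
      by (metis R.m_closed j.hom_add j.hom_mult)
    moreover have "?ev ?w' = j ?w'" using Suc.IH[of ?w'] Suc.prems w' by simp
    ultimately show ?case using skew_eval_shift[OF ctx, of N w] Suc.prems by simp
  qed
  have "\<one>\<^bsub>T\<^esub> \<noteq> \<zero>\<^bsub>T\<^esub>"
  proof
    assume "\<one>\<^bsub>T\<^esub> = \<zero>\<^bsub>T\<^esub>"
    then have "j \<one>\<^bsub>series_ring\<^esub> = \<zero>\<^bsub>T\<^esub>" by simp
    then obtain s where "s \<in> S" "s \<otimes>\<^bsub>series_ring\<^esub> \<one>\<^bsub>series_ring\<^esub> = \<zero>\<^bsub>series_ring\<^esub>"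
      using ker[OF R.one_closed] by blast
    then show False using S S_carr by auto
  qed
  moreover have "J = carrier T" if J: "ideal J T" and nz: "J \<noteq> {\<zero>\<^bsub>T\<^esub>}" for J
  proof -
    interpret J: ideal J T by fact
    note J_zero = additive_subgroup.zero_closed[OF J.additive_subgroup_axioms]
    obtain y where y: "y \<in> J" "y \<noteq> \<zero>\<^bsub>T\<^esub>" using nz J_zero by blast
    then have y_carr: "y \<in> carrier T" using J.Icarr by blast
    then obtain s r where sr: "s \<in> S" "r \<in> carrier series_ring"
      "y = inv\<^bsub>T\<^esub> (j s) \<otimes>\<^bsub>T\<^esub> j r" using frac by blast
    have js: "j s \<in> Units T" using Units sr by blast
    have jr: "j r = j s \<otimes>\<^bsub>T\<^esub> y"
      using js sr by (simp add: T.Units_closed flip: T.m_assoc)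
    then have "j r \<in> J" using J.I_l_closed[OF y(1)] js by (simp add: T.Units_closed)
    moreover have "r \<noteq> \<zero>\<^bsub>series_ring\<^esub>" using sr(3) y(2) js by auto
    ultimately have "{r \<in> carrier series_ring. j r \<in> J} \<noteq> {\<zero>\<^bsub>series_ring\<^esub>}" using sr by blast
    from ideal_meets_polynomials[OF j.ideal_vimage[OF J] this]
    obtain w where w: "w \<in> carrier series_ring" "j w \<in> J" "w \<noteq> \<zero>\<^bsub>series_ring\<^esub>" "w \<in> carrier ?P"
      by (auto simp: poly_ring_simps[OF skew])
    obtain N where "\<And>i. N \<le> i \<Longrightarrow> w i = 0" using w(4) poly_ring_carrier_iff[OF skew] by blast
    then have "?ev w = j w" using ev_eq_j[of w N] w(1) by (auto simp: series_ring_simps)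
    then have "w \<in> {f \<in> carrier ?P. ?ev f \<in> J}" using w by simp
    moreover have "w \<noteq> \<zero>\<^bsub>?P\<^esub>" using w(3) by (simp add: series_ring_simps poly_ring_simps[OF skew])
    ultimately have "{f \<in> carrier ?P. ?ev f \<in> J} = carrier ?P"
      using simple ev.ideal_vimage[OF J] unfolding simple_ring_def by blast
    then have "?ev \<one>\<^bsub>?P\<^esub> \<in> J" using ev.R.one_closed by blast
    then show ?thesis using J.one_imp_carrier by simp
  qed
  ultimately show ?thesis using \<open>ring T\<close> unfolding simple_ring_def by blast
qed

corollary simple_localised_tensor_ring:
  assumes "simple_ring (skew_poly_ring UNIV \<sigma> \<delta>)"
    and T: "localised_tensor_ring (ring_of_type_algebra :: 'q ring) series_ring
      \<O> (\<lambda>r. r) const_series S T"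
    and "\<zero>\<^bsub>series_ring\<^esub> \<notin> S"
  shows "simple_ring T"
proof (rule simple_localisation[OF assms(1) _ _ _ assms(3)])
  let ?Q = "ring_of_type_algebra :: 'q ring"
  let ?t = "pure_tensor ?Q series_ring \<O> (\<lambda>r. r) const_series"
  show loc: "is_localisation series_ring S T (?t \<one>\<^bsub>?Q\<^esub>)"
    and "(\<lambda>a. ?t a \<one>\<^bsub>series_ring\<^esub>) \<in> ring_hom ?Q T"
    using T by (auto simp: localised_tensor_ring_def)
  fix r assume r: "r \<in> \<O>"
  have "ring series_ring" using loc by (simp add: is_localisation_def)
  then interpret R: ring series_ring .
  have "const_series ` \<O> \<subseteq> carrier series_ring"
    by (auto simp: series_ring_simps const_series_def)
  \<comment> \<open>Balancing moves \<open>r\<close> across the tensor sign: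
    \<open>r \<otimes> 1 = 1 \<otimes> r\<close>.\<close>
  then show "?t r \<one>\<^bsub>series_ring\<^esub> = ?t \<one>\<^bsub>?Q\<^esub> (const_series r)"
    using pure_tensor_balanced[of ?Q series_ring "\<lambda>r. r" \<O> const_series "\<one>\<^bsub>?Q\<^esub>" "\<one>\<^bsub>series_ring\<^esub>" r]
      ring_ring_of_type_algebra R.ring_axioms r
    by (auto simp: ring_of_type_algebra_simps image_subset_iff)
qed

end

subsection \<open>Discrete valuation rings\<close>

context
  fixes D :: "'f::division_ring set" and \<pi> :: 'f
  assumes dvr: "discrete_valuation_ring D" and unif: "uniformiser D \<pi>"
begin

abbreviation (input) "R\<^sub>D \<equiv> subring_of_type D"

lemma R_D_simps:
  "carrier R\<^sub>D = D" "r \<otimes>\<^bsub>R\<^sub>D\<^esub> s = r * s" "r \<oplus>\<^bsub>R\<^sub>D\<^esub> s = r + s" "\<one>\<^bsub>R\<^sub>D\<^esub> = 1" "\<zero>\<^bsub>R\<^sub>D\<^esub> = 0"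
  by (simp_all add: ring_of_type_algebra_def)

lemma ring_R_D: "ring R\<^sub>D"
  using dvr by (simp add: discrete_valuation_ring_def two_sided_noetherian_def)

lemma R_D_minus: "d \<in> D \<Longrightarrow> \<ominus>\<^bsub>R\<^sub>D\<^esub> d \<in> D \<and> \<ominus>\<^bsub>R\<^sub>D\<^esub> d = - d"
proof -
  assume d: "d \<in> D"
  interpret ring R\<^sub>D by (rule ring_R_D)
  have "\<ominus>\<^bsub>R\<^sub>D\<^esub> d \<in> D" using a_inv_closed[of d] d by (simp add: R_D_simps ring_of_type_algebra_simps)
  moreover have "\<ominus>\<^bsub>R\<^sub>D\<^esub> d + d = 0" using l_neg[of d] d by (simp add: R_D_simps ring_of_type_algebra_simps)
  ultimately show ?thesis by (simp add: eq_neg_iff_add_eq_0)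
qed

lemma D_closed:
  "0 \<in> D" "1 \<in> D" "a \<in> D \<Longrightarrow> b \<in> D \<Longrightarrow> a + b \<in> D" "a \<in> D \<Longrightarrow> b \<in> D \<Longrightarrow> a * b \<in> D"
  "a \<in> D \<Longrightarrow> - a \<in> D" "a \<in> D \<Longrightarrow> b \<in> D \<Longrightarrow> a - b \<in> D"
proof -
  interpret ring R\<^sub>D by (rule ring_R_D)
  show "0 \<in> D" "1 \<in> D" "a \<in> D \<Longrightarrow> b \<in> D \<Longrightarrow> a * b \<in> D"
    using zero_closed one_closed m_closed[of a b] by (simp_all add: R_D_simps ring_of_type_algebra_simps)
  show add: "a \<in> D \<Longrightarrow> b \<in> D \<Longrightarrow> a + b \<in> D" for a b
    using a_closed[of a b] by (simp add: R_D_simps ring_of_type_algebra_simps)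
  show minus: "a \<in> D \<Longrightarrow> - a \<in> D" for a using R_D_minus[of a] by metis
  show "a \<in> D \<Longrightarrow> b \<in> D \<Longrightarrow> a - b \<in> D" using add[of a "- b"] minus[of b] by simp
qed

lemma D_power: "a \<in> D \<Longrightarrow> a ^ n \<in> D"
  by (induction n) (auto simp: D_closed)

lemma D_total: "z \<in> D \<or> inverse z \<in> D"
  using dvr D_closed(1) by (cases "z = 0") (auto simp: discrete_valuation_ring_def)

text \<open>Closure under negation follows from the other conditions, as
  \<open>- a = (- 1) * a\<close> with \<open>- 1 \<in> D\<close>.\<close>

lemma left_ideal_D_iff:
  "left_ideal I R\<^sub>D \<longleftrightarrow> I \<subseteq> D \<and> 0 \<in> I \<and> (\<forall>a\<in>I. \<forall>b\<in>I. a + b \<in> I) \<and> (\<forall>r\<in>D. \<forall>a\<in>I. r * a \<in> I)"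
proof
  assume I: "left_ideal I R\<^sub>D"
  then have sub: "additive_subgroup I R\<^sub>D" by (simp add: left_ideal_def)
  interpret additive_subgroup I R\<^sub>D by fact
  show "I \<subseteq> D \<and> 0 \<in> I \<and> (\<forall>a\<in>I. \<forall>b\<in>I. a + b \<in> I) \<and> (\<forall>r\<in>D. \<forall>a\<in>I. r * a \<in> I)"
    using a_subset zero_closed a_closed I by (auto simp: left_ideal_def R_D_simps ring_of_type_algebra_simps)
next
  assume I: "I \<subseteq> D \<and> 0 \<in> I \<and> (\<forall>a\<in>I. \<forall>b\<in>I. a + b \<in> I) \<and> (\<forall>r\<in>D. \<forall>a\<in>I. r * a \<in> I)"
  have "- a \<in> I" if "a \<in> I" for a
    using I that D_closed(2,5) by (metis mult_minus1)
  then have "inv\<^bsub>add_monoid R\<^sub>D\<^esub> a \<in> I" if "a \<in> I" for a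
    using that I R_D_minus[of a] unfolding a_inv_def by (metis subsetD)
  then have "subgroup I (add_monoid R\<^sub>D)"
    unfolding subgroup_def using I by (simp add: R_D_simps ring_of_type_algebra_simps)
  then show "left_ideal I R\<^sub>D"
    using I ring_R_D by (auto simp: left_ideal_def R_D_simps ring_of_type_algebra_simps intro: additive_subgroup.intro)
qed

definition U\<^sub>D :: "'f set" where "U\<^sub>D = {u \<in> D. u \<noteq> 0 \<and> inverse u \<in> D}"

lemma U_D_closed: "u \<in> U\<^sub>D \<Longrightarrow> w \<in> U\<^sub>D \<Longrightarrow> u * w \<in> U\<^sub>D" "u \<in> U\<^sub>D \<Longrightarrow> inverse u \<in> U\<^sub>D"
  by (auto simp: U\<^sub>D_def D_closed nonzero_inverse_mult_distrib)

text \<open>Since \<open>a b\<inverse> \<in> D\<close> or \<open>b a\<inverse> \<in> D\<close>, a sum of two nonunits is a multiple of one of them.\<close>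
lemma left_ideal_nonunits: "left_ideal (D - U\<^sub>D) R\<^sub>D"
  unfolding left_ideal_D_iff
proof (intro conjI ballI)
  have mult: "r * a \<in> D - U\<^sub>D" if "r \<in> D" "a \<in> D - U\<^sub>D" for r a
  proof -
    have "a \<in> U\<^sub>D" if u: "r * a \<in> U\<^sub>D"
    proof -
      have nz: "r \<noteq> 0" "a \<noteq> 0" using u by (auto simp: U\<^sub>D_def)
      then have "inverse a = inverse (r * a) * r" by (simp add: nonzero_inverse_mult_distrib mult.assoc)
      then show ?thesis using u nz \<open>r \<in> D\<close> \<open>a \<in> D - U\<^sub>D\<close> D_closed(4) by (auto simp: U\<^sub>D_def)
    qed
    then show ?thesis using that D_closed(4) by blast
  qed
  then show "r * a \<in> D - U\<^sub>D" if "r \<in> D" "a \<in> D - U\<^sub>D" for r a using that .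
  show "a + b \<in> D - U\<^sub>D" if ab: "a \<in> D - U\<^sub>D" "b \<in> D - U\<^sub>D" for a b
  proof (cases "a = 0 \<or> b = 0")
    case False
    show ?thesis
    proof (cases "a * inverse b \<in> D")
      case True
      then have "(a * inverse b + 1) * b \<in> D - U\<^sub>D" using ab by (intro mult D_closed(2,3)) auto
      then show ?thesis using False by (simp add: distrib_right mult.assoc)
    next
      case not: False
      then have "b * inverse a \<in> D"
        using D_total[of "a * inverse b"] False by (simp add: nonzero_inverse_mult_distrib)
      then have "(1 + b * inverse a) * a \<in> D - U\<^sub>D" using ab by (intro mult D_closed(2,3)) auto
      then show ?thesis using False by (simp add: distrib_right mult.assoc)
    qed
  qed (use ab in auto)
qed (auto simp: U\<^sub>D_def D_closed)

text \<open>\<open>D\<close> is local: a left ideal containing a unit is everything, so each proper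
  one consists of nonunits. As the nonunits form a left ideal themselves, they are the only maximal
  one.\<close>

lemma jacobson_radical_eq_nonunits: "jacobson_radical R\<^sub>D = D - U\<^sub>D"
proof -
  have one: "1 \<in> U\<^sub>D" by (simp add: U\<^sub>D_def D_closed)
  have proper: "I = D" if "left_ideal I R\<^sub>D" "u \<in> I" "u \<in> U\<^sub>D" for I u
  proof -
    have "inverse u * u \<in> I" using that unfolding left_ideal_D_iff U\<^sub>D_def by blast
    then have "1 \<in> I" using that(3) by (simp add: U\<^sub>D_def)
    then show ?thesis using that(1) unfolding left_ideal_D_iff by (metis mult.right_neutral subsetI subset_antisym)
  qed
  have ne: "D - U\<^sub>D \<noteq> D" using one D_closed(2) by blast
  have sub: "I \<subseteq> D - U\<^sub>D" if "left_ideal I R\<^sub>D" "I \<noteq> D" for I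
  proof -
    have "I \<subseteq> D" using that(1) unfolding left_ideal_D_iff by simp
    then show ?thesis using proper[OF that(1)] that(2) by blast
  qed
  have "maximal_left_ideal (D - U\<^sub>D) R\<^sub>D"
    unfolding maximal_left_ideal_def R_D_simps
    using left_ideal_nonunits ne sub by (metis subset_antisym)
  moreover have "M = D - U\<^sub>D" if M: "maximal_left_ideal M R\<^sub>D" for M
  proof -
    have "left_ideal M R\<^sub>D" "M \<noteq> D" using M unfolding maximal_left_ideal_def R_D_simps by simp_all
    from sub[OF this] have "D - U\<^sub>D = M \<or> D - U\<^sub>D = D"
      using M left_ideal_nonunits unfolding maximal_left_ideal_def R_D_simps by simp
    then show ?thesis using ne by simp
  qed
  ultimately show ?thesis unfolding jacobson_radical_def R_D_simps by blast
qed

lemma uniformiser_D: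
  "\<pi> \<in> D" "D - U\<^sub>D = (\<lambda>d. \<pi> * d) ` D" "D - U\<^sub>D = (\<lambda>d. d * \<pi>) ` D" "\<pi> \<notin> U\<^sub>D"
proof -
  show *: "\<pi> \<in> D" "D - U\<^sub>D = (\<lambda>d. \<pi> * d) ` D" "D - U\<^sub>D = (\<lambda>d. d * \<pi>) ` D"
    using unif unfolding uniformiser_def jacobson_radical_eq_nonunits by blast+
  have "\<pi> * 1 \<in> D - U\<^sub>D" unfolding *(2) using D_closed(2) by blast
  then show "\<pi> \<notin> U\<^sub>D" by simp
qed

lemma dvr_filtration_zero: "dvr_filtration D \<pi> 0 = \<infinity>"
  unfolding dvr_filtration_def
proof (rule SUP_PInfty)
  fix n :: nat
  have "0 \<in> (\<lambda>d. \<pi> powi int n * d) ` D" using D_closed(1) by (intro image_eqI[of _ _ 0]) auto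
  then show "\<exists>k\<in>{k. 0 \<in> (\<lambda>d. \<pi> powi k * d) ` D}. ereal (real n) \<le> ereal (of_int k)"
    by (intro bexI[of _ "int n"]) auto
qed

text \<open>The case of zero radical: every nonzero element of \<open>D\<close> is a unit, so
  \<open>D\<close> contains \<open>z\<close> as soon as it contains \<open>inverse z\<close>. Since
  \<open>0 powi k\<close> is 1 for \<open>k = 0\<close> and 0 otherwise, a nonzero \<open>z\<close>
  admits the exponent 0 only.\<close>

lemma dvr_filtration_trivial:
  assumes "\<pi> = 0"
  shows "D = UNIV" "z \<noteq> 0 \<Longrightarrow> dvr_filtration D \<pi> z = 0"
proof -
  have "D - U\<^sub>D = {0}" using uniformiser_D(2) assms D_closed(1) by auto
  then have units: "inverse u \<in> D" if "u \<in> D" "u \<noteq> 0" for u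
    using that unfolding U\<^sub>D_def by blast
  have "z \<in> D" for z
    using D_total[of z] units[of "inverse z"] D_closed(1) by (cases "z = 0") auto
  then show D: "D = UNIV" by blast
  assume "z \<noteq> 0"
  then have "{k::int. z \<in> (\<lambda>d. \<pi> powi k * d) ` D} = {0}"
    unfolding D assms by (auto simp: power_int_0_left_if split: if_splits intro: image_eqI[of _ _ z])
  then show "dvr_filtration D \<pi> z = 0" by (simp add: dvr_filtration_def zero_ereal_def)
qed

section \<open>Powers of a nonzero uniformiser\<close>

context
  assumes nz: "\<pi> \<noteq> 0"
begin

lemma inverse_uniformiser_notin: "inverse \<pi> \<notin> D"
  using uniformiser_D(1,4) nz by (auto simp: U\<^sub>D_def)

lemma powi_add: "\<pi> powi (k + l) = \<pi> powi k * \<pi> powi l"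
  using nz by (simp add: power_int_add)

lemma conj_uniformiser: "d \<in> D \<Longrightarrow> inverse \<pi> * d * \<pi> \<in> D" "d \<in> D \<Longrightarrow> \<pi> * d * inverse \<pi> \<in> D"
proof -
  assume d: "d \<in> D"
  obtain d' where "d' \<in> D" "d * \<pi> = \<pi> * d'" using uniformiser_D(2,3) d by blast
  then show "inverse \<pi> * d * \<pi> \<in> D" using nz by (simp add: mult.assoc) (simp flip: mult.assoc)
  obtain d' where "d' \<in> D" "\<pi> * d = d' * \<pi>" using uniformiser_D(2,3) d by blast
  then show "\<pi> * d * inverse \<pi> \<in> D" using nz by (simp add: mult.assoc)
qed

text \<open>This replaces commutativity: by \<open>\<pi> D = D \<pi>\<close>, powers of \<pi> can be
  collected on the left. Negative exponents are included because elements outside \<open>D\<close>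
  involve them.\<close>

lemma conj_powi: "d \<in> D \<Longrightarrow> \<pi> powi (- k) * d * \<pi> powi k \<in> D"
proof (induction k rule: int_induct[where k = 0])
  case (step1 k)
  have "\<pi> powi (- (k + 1)) * d * \<pi> powi (k + 1) = inverse \<pi> * (\<pi> powi (- k) * d * \<pi> powi k) * \<pi>"
    using powi_add[of "- 1" "- k"] powi_add[of k 1]
    by (simp only: minus_add_distrib add.commute[of "- k"]) (simp add: mult.assoc)
  then show ?case using conj_uniformiser(1) step1 by simp
next
  case (step2 k)
  have "\<pi> powi (- (k - 1)) * d * \<pi> powi (k - 1) = \<pi> * (\<pi> powi (- k) * d * \<pi> powi k) * inverse \<pi>"
    using powi_add[of 1 "- k"] powi_add[of k "- 1"]
    by (simp only: minus_diff_eq diff_conv_add_uminus) (simp add: mult.assoc)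
  then show ?case using conj_uniformiser(2) step2 by simp
qed simp

lemma conj_powi_unit:
  assumes "u \<in> U\<^sub>D" shows "\<pi> powi (- k) * u * \<pi> powi k \<in> U\<^sub>D"
proof -
  have "inverse (\<pi> powi (- k) * u * \<pi> powi k) = \<pi> powi (- k) * inverse u * \<pi> powi k"
    using assms nz
    by (simp add: nonzero_inverse_mult_distrib U\<^sub>D_def power_int_minus mult.assoc)
  then show ?thesis using assms conj_powi[of u k] conj_powi[of "inverse u" k] nz
    by (auto simp: U\<^sub>D_def)
qed

text \<open>
  If \<open>z\<close> were divisible by every power of \<open>\<pi>\<close>, the left ideals generated by the elements
  \<open>\<pi>\<^sup>-\<^sup>n z\<close> would form a strictly increasing chain.
\<close>
lemma integral_decomposition:
  assumes "z \<in> D" "z \<noteq> 0"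
  shows "\<exists>n::nat. \<exists>u\<in>U\<^sub>D. z = \<pi> ^ n * u"
proof -
  let ?y = "\<lambda>n::nat. inverse (\<pi> ^ n) * z"
  have y_Suc: "?y (Suc n) = inverse \<pi> * ?y n" for n
    using nz by (simp add: nonzero_inverse_mult_distrib power_Suc2 mult.assoc del: power_Suc)
  have "\<exists>n. ?y n \<in> D \<and> ?y (Suc n) \<notin> D"
  proof (rule ccontr)
    assume *: "\<not> ?thesis"
    have y: "?y n \<in> D" for n
      by (induction n) (use * assms in auto)
    define C where "C n = (\<lambda>d. d * ?y n) ` D" for n
    have "left_ideal (C n) R\<^sub>D" for n
      unfolding left_ideal_D_iff C_def
    proof (intro conjI ballI)
      show "a + b \<in> (\<lambda>d. d * ?y n) ` D"
        if "a \<in> (\<lambda>d. d * ?y n) ` D" "b \<in> (\<lambda>d. d * ?y n) ` D" for a b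
        using that D_closed(3) by (auto simp flip: distrib_right)
      show "r * a \<in> (\<lambda>d. d * ?y n) ` D" if "r \<in> D" "a \<in> (\<lambda>d. d * ?y n) ` D" for r a
        using that D_closed(4) by (auto simp flip: mult.assoc)
      show "0 \<in> (\<lambda>d. d * ?y n) ` D" using D_closed(1) by (intro image_eqI[of _ _ 0]) auto
    qed (use y D_closed in auto)
    moreover have "incseq C"
    proof (rule incseq_SucI)
      fix n
      have "?y n = \<pi> * ?y (Suc n)"
        unfolding y_Suc using nz by (simp flip: mult.assoc)
      then have "d * ?y n = (d * \<pi>) * ?y (Suc n)" for d by (simp only: mult.assoc)
      then show "C n \<subseteq> C (Suc n)"
        unfolding C_def using D_closed(4) uniformiser_D(1) by auto
    qed
    ultimately obtain N where N: "\<forall>k\<ge>N. C k = C N"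
      using dvr unfolding discrete_valuation_ring_def two_sided_noetherian_def acc_on_def by blast
    have "C (Suc N) = C N" by (rule N[rule_format]) simp
    moreover have "?y (Suc N) \<in> C (Suc N)" unfolding C_def using D_closed(2) by force
    ultimately obtain d where d: "d \<in> D" "?y (Suc N) = d * ?y N" unfolding C_def by auto
    have "inverse \<pi> * inverse (\<pi> ^ N) * z = d * inverse (\<pi> ^ N) * z"
      using d(2) unfolding y_Suc by (simp only: mult.assoc)
    then have "inverse \<pi> = d" using assms(2) nz by simp
    then show False using d(1) inverse_uniformiser_notin by simp
  qed
  then obtain n where n: "?y n \<in> D" "?y (Suc n) \<notin> D" by blast
  \<comment> \<open>\<open>n\<close> is an exponent at which divisibility stops. A nonunit
    \<open>?y n\<close> would be divisible by \<pi> once more.\<close>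
  have "?y n \<in> U\<^sub>D"
  proof (rule ccontr)
    assume "?y n \<notin> U\<^sub>D"
    then obtain d where d: "d \<in> D" "?y n = \<pi> * d" using uniformiser_D(2) n by blast
    have "?y (Suc n) = d" unfolding y_Suc d(2) using nz by (simp flip: mult.assoc)
    with d(1) n(2) show False by simp
  qed
  moreover have "z = \<pi> ^ n * ?y n" using nz by (simp flip: mult.assoc)
  ultimately show ?thesis by blast
qed

lemma decomposition:
  assumes "z \<noteq> 0" shows "\<exists>k::int. \<exists>u\<in>U\<^sub>D. z = \<pi> powi k * u"
proof (cases "z \<in> D")
  case True
  then obtain n u where "u \<in> U\<^sub>D" "z = \<pi> ^ n * u" using integral_decomposition assms by blast
  then show ?thesis by (intro exI[of _ "int n"] bexI[of _ u]) simp_all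
next
  case False
  then have "inverse z \<in> D" "inverse z \<noteq> 0" using D_total[of z] assms by auto
  then obtain n u where u: "u \<in> U\<^sub>D" "inverse z = \<pi> ^ n * u" using integral_decomposition by blast
  have u0: "u \<noteq> 0" using u(1) by (simp add: U\<^sub>D_def)
  have "z = inverse (\<pi> ^ n * u)" using u(2) by (metis inverse_inverse_eq)
  also have "\<dots> = inverse u * \<pi> powi (- int n)"
    using nz u0 by (simp add: nonzero_inverse_mult_distrib power_int_minus)
  \<comment> \<open>Inversion has put the power of \<pi> on the right; conjugating the unit by it
    moves it back to the left.\<close>
  also have "\<dots> = \<pi> powi (- int n) * (\<pi> powi (- (- int n)) * inverse u * \<pi> powi (- int n))"
    using nz by (simp add: power_int_minus flip: mult.assoc)
  finally show ?thesis using conj_powi_unit[OF U_D_closed(2)[OF u(1)], of "- int n"] by blast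
qed

lemma powi_mult_in_iff:
  assumes "u \<in> U\<^sub>D" shows "\<pi> powi k * u \<in> D \<longleftrightarrow> 0 \<le> k"
proof
  assume "0 \<le> k"
  then have "\<pi> powi k = \<pi> ^ nat k" by (simp add: power_int_nonneg_exp)
  then show "\<pi> powi k * u \<in> D" using assms D_power[OF uniformiser_D(1)]
    by (simp add: D_closed(4) U\<^sub>D_def)
next
  assume *: "\<pi> powi k * u \<in> D"
  show "0 \<le> k"
  proof (rule ccontr)
    assume "\<not> 0 \<le> k"
    have "\<pi> powi k * u * inverse u \<in> D" using assms by (intro D_closed(4)[OF *]) (simp add: U\<^sub>D_def)
    then have "\<pi> powi k \<in> D" using assms by (simp add: U\<^sub>D_def mult.assoc)
    \<comment> \<open>The exponent \<open>- 1 - k\<close> is nonnegative for negative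
      \<open>k\<close> and is chosen to leave exactly the inverse of \<pi>, which is not in
      \<open>D\<close>.\<close>
    then have "\<pi> ^ nat (- 1 - k) * \<pi> powi k \<in> D"
      using D_closed(4) D_power[OF uniformiser_D(1)] by blast
    moreover have "\<pi> ^ nat (- 1 - k) = \<pi> powi (- 1 - k)"
      using \<open>\<not> 0 \<le> k\<close> by (simp add: power_int_nonneg_exp)
    ultimately have "\<pi> powi (- 1) \<in> D" using powi_add[of "- 1 - k" k] by simp
    then show False using inverse_uniformiser_notin by (simp add: power_int_minus)
  qed
qed

lemma in_powi_image_iff: "z \<in> (\<lambda>d. \<pi> powi l * d) ` D \<longleftrightarrow> \<pi> powi (- l) * z \<in> D"
proof
  assume "\<pi> powi (- l) * z \<in> D"
  moreover have "z = \<pi> powi l * (\<pi> powi (- l) * z)"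
    using nz by (simp add: power_int_minus flip: mult.assoc)
  ultimately show "z \<in> (\<lambda>d. \<pi> powi l * d) ` D" by blast
qed (use nz in \<open>auto simp: power_int_minus simp flip: mult.assoc\<close>)

lemma dvr_filtration_eq:
  assumes "u \<in> U\<^sub>D" shows "dvr_filtration D \<pi> (\<pi> powi k * u) = ereal (of_int k)"
proof -
  have "\<pi> powi (- l) * (\<pi> powi k * u) = \<pi> powi (k - l) * u" for l
    using powi_add[of "- l" k] by (simp add: mult.assoc)
  then have "{l. \<pi> powi k * u \<in> (\<lambda>d. \<pi> powi l * d) ` D} = {l. l \<le> k}"
    unfolding in_powi_image_iff using powi_mult_in_iff[OF assms] by auto
  then show ?thesis
    unfolding dvr_filtration_def by (auto intro!: antisym SUP_least SUP_upper)
qed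

end

lemma dvr_filtration_integral:
  "z \<noteq> 0 \<Longrightarrow> \<exists>k::int. dvr_filtration D \<pi> z = ereal (of_int k)"
proof (cases "\<pi> = 0")
  case True
  assume "z \<noteq> 0"
  then show ?thesis using dvr_filtration_trivial(2)[OF True] by (intro exI[of _ 0]) (simp add: zero_ereal_def)
next
  case False
  assume "z \<noteq> 0"
  then show ?thesis using decomposition[OF False] dvr_filtration_eq[OF False] by metis
qed

lemma dvr_filtration_eq_infinity_iff: "dvr_filtration D \<pi> z = \<infinity> \<longleftrightarrow> z = 0"
  using dvr_filtration_zero dvr_filtration_integral by force

lemma dvr_filtration_mult:
  "dvr_filtration D \<pi> (z * w) = dvr_filtration D \<pi> z + dvr_filtration D \<pi> w"
proof (cases "z = 0 \<or> w = 0")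
  case True
  have "dvr_filtration D \<pi> x \<noteq> - \<infinity>" for x
    using dvr_filtration_zero dvr_filtration_integral by (cases "x = 0") force+
  with True show ?thesis by (auto simp: dvr_filtration_zero)
next
  case zw: False
  show ?thesis
  proof (cases "\<pi> = 0")
    case True
    then show ?thesis using zw dvr_filtration_trivial(2)[OF True] by simp
  next
    case False
    obtain k u where u: "u \<in> U\<^sub>D" "z = \<pi> powi k * u" using decomposition[OF False] zw by blast
    obtain l t where t: "t \<in> U\<^sub>D" "w = \<pi> powi l * t" using decomposition[OF False] zw by blast
    have "z * w = \<pi> powi (k + l) * ((\<pi> powi (- l) * u * \<pi> powi l) * t)"
      unfolding u t powi_add[OF False] using False
      by (simp add: mult.assoc power_int_minus) (simp flip: mult.assoc)
    moreover have "(\<pi> powi (- l) * u * \<pi> powi l) * t \<in> U\<^sub>D"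
      by (intro U_D_closed(1) conj_powi_unit[OF False] u t)
    ultimately have "dvr_filtration D \<pi> (z * w) = ereal (of_int (k + l))"
      using dvr_filtration_eq[OF False] by metis
    then show ?thesis using dvr_filtration_eq[OF False] u t by simp
  qed
qed

text \<open>For nonzero \<pi> the elements of value at least \<open>k\<close> form
  \<open>\<pi>^k D\<close>, which is closed under subtraction. If both values exceeded
  \<open>k\<close>, the value of \<open>z - w\<close>, then \<open>z - w\<close> would lie in
  \<open>\<pi>^(k+1) D\<close>.\<close>

lemma dvr_filtration_diff:
  "min (dvr_filtration D \<pi> z) (dvr_filtration D \<pi> w) \<le> dvr_filtration D \<pi> (z - w)"
proof (cases "\<pi> = 0")
  case True
  then show ?thesis using dvr_filtration_trivial(2)[OF True] dvr_filtration_zero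
    by (cases "z = 0"; cases "w = 0"; cases "z = w") auto
next
  case False
  have *: "ereal (of_int k) \<le> dvr_filtration D \<pi> x \<longleftrightarrow> \<pi> powi (- k) * x \<in> D" for k x
  proof (cases "x = 0")
    case x: False
    obtain l u where u: "u \<in> U\<^sub>D" "x = \<pi> powi l * u" using decomposition[OF False x] by blast
    have "\<pi> powi (- k) * x = \<pi> powi (l - k) * u"
      using powi_add[OF False, of "- k" l] u by (simp add: mult.assoc)
    then show ?thesis
      using dvr_filtration_eq[OF False u(1), of l] powi_mult_in_iff[OF False u(1), of "l - k"] u by simp
  qed (simp add: dvr_filtration_zero D_closed)
  show ?thesis
  proof (cases "z - w = 0")
    case nz: False
    obtain k :: int where k: "dvr_filtration D \<pi> (z - w) = ereal (of_int k)"
      using dvr_filtration_integral[OF nz] by blast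
    show ?thesis
    proof (rule ccontr)
      assume "\<not> ?thesis"
      then have less: "ereal (of_int k) < dvr_filtration D \<pi> z" "ereal (of_int k) < dvr_filtration D \<pi> w"
        using k by (simp_all add: min_le_iff_disj not_le)
      have "ereal (of_int (k + 1)) \<le> dvr_filtration D \<pi> x" if "ereal (of_int k) < dvr_filtration D \<pi> x" for x
      proof (cases "x = 0")
        case x: False
        obtain l :: int where "dvr_filtration D \<pi> x = ereal (of_int l)"
          using dvr_filtration_integral[OF x] by blast
        with that show ?thesis by simp
      qed (simp add: dvr_filtration_zero)
      with less have "\<pi> powi (- (k + 1)) * z \<in> D" "\<pi> powi (- (k + 1)) * w \<in> D" unfolding * by auto
      then have "\<pi> powi (- (k + 1)) * (z - w) \<in> D" unfolding right_diff_distrib by (rule D_closed(6))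
      then have "ereal (of_int (k + 1)) \<le> ereal (of_int k)" unfolding *[symmetric] k .
      then show False by simp
    qed
  qed (simp add: dvr_filtration_zero)
qed

lemma dvr_filtration_nonneg_iff: "0 \<le> dvr_filtration D \<pi> z \<longleftrightarrow> z \<in> D"
proof (cases "z = 0")
  case True
  then show ?thesis by (simp add: dvr_filtration_zero D_closed)
next
  case z: False
  show ?thesis
  proof (cases "\<pi> = 0")
    case True
    then show ?thesis using z dvr_filtration_trivial[OF True] by simp
  next
    case False
    obtain k u where u: "u \<in> U\<^sub>D" "z = \<pi> powi k * u" using decomposition[OF False z] by blast
    show ?thesis
      using dvr_filtration_eq[OF False u(1), of k] powi_mult_in_iff[OF False u(1), of k] u(2) by simp
  qed
qed

end

subsection \<open>Matrix filtrations\<close>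

lemma le_matrix_filtration_iff:
  fixes A :: "'f ^ 'n ^ 'n"
  shows "c \<le> matrix_filtration v A \<longleftrightarrow> (\<forall>i j. c \<le> v (A $ i $ j))"
  by (auto simp: matrix_filtration_def)

lemma less_matrix_filtration_iff:
  fixes A :: "'f ^ 'n ^ 'n"
  shows "c < matrix_filtration v A \<longleftrightarrow> (\<forall>i j. c < v (A $ i $ j))"
  by (auto simp: matrix_filtration_def)

lemma matrix_filtration_attained:
  fixes A :: "'f ^ 'n ^ 'n"
  shows "\<exists>i j. matrix_filtration v A = v (A $ i $ j)"
proof -
  have "Min (range (\<lambda>(i, j). v (A $ i $ j))) \<in> range (\<lambda>(i, j). v (A $ i $ j))"
    by (rule Min_in) auto
  then obtain p where "Min (range (\<lambda>(i, j). v (A $ i $ j))) = (case p of (i, j) \<Rightarrow> v (A $ i $ j))"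
    by blast
  then show ?thesis unfolding matrix_filtration_def by (cases p) auto
qed

section \<open>Matrix units and scalar matrices\<close>

definition matrix_unit :: "'n \<Rightarrow> 'n \<Rightarrow> 'f::ring_1 ^ 'n ^ 'n"
  where "matrix_unit i j = (\<chi> r s. if r = i \<and> s = j then 1 else 0)"

lemma matrix_unit_mult_entry:
  fixes A :: "'f::ring_1 ^ 'n ^ 'n"
  shows "(matrix_unit l i ** A ** matrix_unit j l') $ r $ s
    = (if r = l \<and> s = l' then A $ i $ j else 0)"
proof -
  have "(matrix_unit l i ** A) $ r $ k = (if r = l then A $ i $ k else 0)" for k
  proof -
    have "(matrix_unit l i ** A) $ r $ k
        = (\<Sum>m\<in>UNIV. if m = i then (if r = l then A $ i $ k else 0) else 0)"
      unfolding matrix_matrix_mult_def matrix_unit_def vec_lambda_beta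
      by (rule sum.cong) auto
    then show ?thesis by simp
  qed
  then have "(matrix_unit l i ** A ** matrix_unit j l') $ r $ s
      = (\<Sum>k\<in>UNIV. if k = j then (if r = l \<and> s = l' then A $ i $ j else 0) else 0)"
    unfolding matrix_matrix_mult_def[of "matrix_unit l i ** A"] matrix_unit_def[of j] vec_lambda_beta
    by (intro sum.cong) auto
  then show ?thesis by simp
qed

text \<open>The summand with index \<open>l\<close> carries the entry at \<open>(i, j)\<close> to
  the place \<open>(l, l)\<close>. This is how one entry of a matrix yields a scalar matrix in the
  two-sided ideal that the matrix generates.\<close>

lemma mat_eq_sum_matrix_units:
  fixes A :: "'f::ring_1 ^ 'n ^ 'n"
  shows "mat (A $ i $ j) = (\<Sum>l\<in>UNIV. matrix_unit l i ** A ** matrix_unit j l)"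
proof -
  have "(\<Sum>l\<in>UNIV. (matrix_unit l i ** A ** matrix_unit j l) $ r $ s)
      = (\<Sum>l\<in>UNIV. if l = r then (if r = s then A $ i $ j else 0) else 0)" for r s
    by (rule sum.cong) (auto simp: matrix_unit_mult_entry)
  then show ?thesis by (simp add: vec_eq_iff mat_def)
qed

lemma mat_mult_mat:
  fixes a b :: "'f::ring_1"
  shows "(mat a ** mat b :: 'f ^ 'n ^ 'n) = mat (a * b)"
proof -
  have "(mat a ** mat b :: 'f ^ 'n ^ 'n) $ r $ s
      = (\<Sum>k\<in>UNIV. if k = r then (if r = s then a * b else 0) else 0)" for r s
    unfolding matrix_matrix_mult_def mat_def vec_lambda_beta by (rule sum.cong) auto
  then show ?thesis by (simp add: vec_eq_iff mat_def)
qed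

section \<open>The filtration on \<open>Q\<close> induced by the matrix ring\<close>

context
  fixes D :: "'f::division_ring set" and \<pi> :: 'f
    and \<iota> :: "'q::ring_1 \<Rightarrow> 'f ^ 'n ^ 'n"
  assumes dvr: "discrete_valuation_ring D" and unif: "uniformiser D \<pi>"
    and complete: "filt_complete (dvr_filtration D \<pi>) D"
    and \<iota>: "\<iota> \<in> ring_iso (ring_of_type_algebra :: 'q ring) matrix_ring"
begin

abbreviation (input) "v\<^sub>D \<equiv> dvr_filtration D \<pi>"
abbreviation (input) "v\<^sub>M \<equiv> \<lambda>q. matrix_filtration v\<^sub>D (\<iota> q)"

lemma iota_simps:
  "bij \<iota>" "\<iota> (r + s) = \<iota> r + \<iota> s" "\<iota> (r * s) = \<iota> r ** \<iota> s" "\<iota> 1 = mat 1"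
  "\<iota> 0 = 0" "\<iota> (r - s) = \<iota> r - \<iota> s" "\<iota> q = 0 \<longleftrightarrow> q = 0" "\<iota> (inv_into UNIV \<iota> A) = A"
proof -
  show bij: "bij \<iota>" and add: "\<iota> (r + s) = \<iota> r + \<iota> s" and "\<iota> (r * s) = \<iota> r ** \<iota> s" "\<iota> 1 = mat 1" for r s
    using \<iota> by (auto simp: ring_iso_def ring_hom_def ring_of_type_algebra_simps matrix_ring_def)
  show zero: "\<iota> 0 = 0" using add[of 0 0] by simp
  show "\<iota> (r - s) = \<iota> r - \<iota> s" using add[of "r - s" s] by (simp add: eq_diff_eq)
  show "\<iota> q = 0 \<longleftrightarrow> q = 0" using zero bij by (metis bij_is_inj injD)
  show "\<iota> (inv_into UNIV \<iota> A) = A" using bij by (simp add: bij_is_surj surj_f_inv_f)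
qed

lemma iota_sum: "\<iota> (\<Sum>i\<in>I. f i) = (\<Sum>i\<in>I. \<iota> (f i))"
  by (induction I rule: infinite_finite_induct) (simp_all add: iota_simps)

lemma dvr_filtration_sum_ge:
  "(\<And>i. i \<in> I \<Longrightarrow> c \<le> v\<^sub>D (f i)) \<Longrightarrow> c \<le> v\<^sub>D (sum f I)"
proof (induction I rule: infinite_finite_induct)
  case (insert i I)
  note diff = dvr_filtration_diff[OF dvr unif]
  have neg: "v\<^sub>D x \<le> v\<^sub>D (- x)" for x
    using diff[of 0 x] by (simp add: dvr_filtration_zero[OF dvr unif])
  have "c \<le> min (v\<^sub>D (f i)) (v\<^sub>D (sum f I))" using insert by simp
  also have "\<dots> \<le> min (v\<^sub>D (f i)) (v\<^sub>D (- sum f I))" using neg by (intro min.mono) auto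
  also have "\<dots> \<le> v\<^sub>D (f i + sum f I)" using diff[of "f i" "- sum f I"] by simp
  finally show ?case using insert by simp
qed (simp_all add: dvr_filtration_zero[OF dvr unif])

lemma dvr_filtration_one: "v\<^sub>D 1 = 0"
  using dvr_filtration_mult[OF dvr unif, of 1 1] dvr_filtration_integral[OF dvr unif, of 1]
  by (auto simp: zero_ereal_def)

lemma v_M_nonneg_iff: "0 \<le> v\<^sub>M q \<longleftrightarrow> \<iota> q \<in> matrices_over D"
  by (simp add: le_matrix_filtration_iff dvr_filtration_nonneg_iff[OF dvr unif] matrices_over_def)

text \<open>Limits are taken entry by entry; since there are only finitely many entries, one index
  serves for all of them.\<close>

lemma v_M_complete: "filt_complete v\<^sub>M {r. 0 \<le> v\<^sub>M r}"
  unfolding filt_complete_def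
proof (intro allI impI)
  fix s :: "nat \<Rightarrow> 'q"
  assume s: "(\<forall>m. s m \<in> {r. 0 \<le> v\<^sub>M r}) \<and> filt_Cauchy v\<^sub>M s"
  have "\<exists>l\<in>D. filt_tendsto v\<^sub>D (\<lambda>m. \<iota> (s m) $ i $ j) l" for i j
  proof (rule complete[unfolded filt_complete_def, rule_format], intro conjI allI)
    show "\<iota> (s m) $ i $ j \<in> D" for m
      using s by (simp add: v_M_nonneg_iff matrices_over_def)
    show "filt_Cauchy v\<^sub>D (\<lambda>m. \<iota> (s m) $ i $ j)"
      unfolding filt_Cauchy_def
    proof
      fix B :: real
      obtain M where "\<forall>m\<ge>M. \<forall>m'\<ge>M. ereal B \<le> v\<^sub>M (s m - s m')"
        using s unfolding filt_Cauchy_def by blast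
      then show "\<exists>M. \<forall>m\<ge>M. \<forall>m'\<ge>M. ereal B \<le> v\<^sub>D (\<iota> (s m) $ i $ j - \<iota> (s m') $ i $ j)"
        by (intro exI[of _ M]) (simp add: le_matrix_filtration_iff iota_simps)
    qed
  qed
  then obtain L where L: "\<And>i j. L i j \<in> D" "\<And>i j. filt_tendsto v\<^sub>D (\<lambda>m. \<iota> (s m) $ i $ j) (L i j)"
    by metis
  define l where "l = inv_into UNIV \<iota> (\<chi> i j. L i j)"
  have l: "\<iota> l $ i $ j = L i j" for i j by (simp add: l_def iota_simps)
  have "filt_tendsto v\<^sub>M s l"
    unfolding filt_tendsto_def tendsto_PInfty less_matrix_filtration_iff
  proof (intro allI eventually_all_finite)
    fix B i j
    have "eventually (\<lambda>m. ereal B < v\<^sub>D (\<iota> (s m) $ i $ j - L i j)) sequentially"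
      using L(2)[of i j] unfolding filt_tendsto_def tendsto_PInfty by blast
    then show "eventually (\<lambda>m. ereal B < v\<^sub>D (\<iota> (s m - l) $ i $ j)) sequentially"
      by (simp add: iota_simps l)
  qed
  moreover have "0 \<le> v\<^sub>M l" using L(1) by (simp add: v_M_nonneg_iff matrices_over_def l)
  ultimately show "\<exists>l\<in>{r. 0 \<le> v\<^sub>M r}. filt_tendsto v\<^sub>M s l" by blast
qed

lemma v_M_mult: "v\<^sub>M r + v\<^sub>M s \<le> v\<^sub>M (r * s)"
proof (subst le_matrix_filtration_iff, intro allI)
  fix i j
  have "v\<^sub>M r + v\<^sub>M s \<le> v\<^sub>D (\<iota> r $ i $ k * \<iota> s $ k $ j)" for k
    unfolding dvr_filtration_mult[OF dvr unif]
    using le_matrix_filtration_iff[of "v\<^sub>M r" v\<^sub>D "\<iota> r"] le_matrix_filtration_iff[of "v\<^sub>M s" v\<^sub>D "\<iota> s"]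
    by (intro add_mono) auto
  then show "v\<^sub>M r + v\<^sub>M s \<le> v\<^sub>D (\<iota> (r * s) $ i $ j)"
    by (simp add: iota_simps matrix_matrix_mult_def dvr_filtration_sum_ge)
qed

text \<open>For an entry \<open>a\<close> of least value the unit is the scalar matrix
  \<open>mat a\<close>: integral matrix units produce it from \<open>r\<close>. Its inverse has
  value \<open>- k\<close> because the filtration of \<open>F\<close> is exactly multiplicative, not
  just submultiplicative like that of matrices.\<close>

lemma v_M_unit_of_value:
  assumes r: "v\<^sub>M r = ereal (of_int k)" "r \<in> J" "0 \<in> J"
    and add: "\<And>a b. a \<in> J \<Longrightarrow> b \<in> J \<Longrightarrow> a + b \<in> J"
    and mult: "\<And>a b. a \<in> J \<Longrightarrow> 0 \<le> v\<^sub>M b \<Longrightarrow> a * b \<in> J"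
      "\<And>a b. a \<in> J \<Longrightarrow> 0 \<le> v\<^sub>M b \<Longrightarrow> b * a \<in> J"
  shows "\<exists>u\<in>J. \<exists>u'. u * u' = 1 \<and> u' * u = 1 \<and> ereal (of_int (- k)) \<le> v\<^sub>M u'"
proof -
  obtain i j where ij: "v\<^sub>D (\<iota> r $ i $ j) = ereal (of_int k)"
    using matrix_filtration_attained[of v\<^sub>D "\<iota> r"] r(1) by auto
  define a where "a = \<iota> r $ i $ j"
  have a: "a \<noteq> 0" using ij dvr_filtration_zero[OF dvr unif] by (auto simp: a_def)
  let ?m = "inv_into UNIV \<iota>"
  let ?e = "\<lambda>i j. ?m (matrix_unit i j)"
  have e_int: "0 \<le> v\<^sub>M (?e i j)" for i j
    unfolding v_M_nonneg_iff using D_closed(1,2)[OF dvr unif]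
    by (simp add: iota_simps matrices_over_def matrix_unit_def)
  have "\<iota> (\<Sum>l\<in>UNIV. ?e l i * r * ?e j l) = mat a"
    by (simp add: iota_sum iota_simps a_def mat_eq_sum_matrix_units)
  then have eq: "?m (mat a) = (\<Sum>l\<in>UNIV. ?e l i * r * ?e j l)"
    by (rule inv_f_eq[OF bij_is_inj[OF iota_simps(1)]])
  have "(\<Sum>l\<in>I. ?e l i * r * ?e j l) \<in> J" for I
    by (induction I rule: infinite_finite_induct) (auto intro: add mult r e_int)
  then have "?m (mat a) \<in> J" unfolding eq .
  moreover have inj: "x = y" if "\<iota> x = \<iota> y" for x y
    using that by (rule injD[OF bij_is_inj[OF iota_simps(1)]])
  have "?m (mat a) * ?m (mat (inverse a)) = 1" "?m (mat (inverse a)) * ?m (mat a) = 1"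
    using a by (auto intro!: inj simp: iota_simps mat_mult_mat)
  moreover have "ereal (of_int (- k)) \<le> v\<^sub>M (?m (mat (inverse a)))"
  proof -
    obtain l :: int where l: "v\<^sub>D (inverse a) = ereal (of_int l)"
      using dvr_filtration_integral[OF dvr unif, of "inverse a"] a by auto
    have "v\<^sub>D (a * inverse a) = ereal (of_int k) + ereal (of_int l)"
      unfolding dvr_filtration_mult[OF dvr unif] l ij[folded a_def] ..
    then have "l = - k" using a dvr_filtration_one by (simp add: zero_ereal_def)
    then show ?thesis using l
      by (auto simp: le_matrix_filtration_iff iota_simps mat_def dvr_filtration_zero[OF dvr unif])
  qed
  ultimately show ?thesis by blast
qed

lemma complete_filtered_skew_ring_v_M:
  assumes "skew_derivation \<sigma> \<delta>" "filt_compatible v\<^sub>M \<sigma> \<delta>"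
  shows "complete_filtered_skew_ring v\<^sub>M \<sigma> \<delta>"
proof
  fix r s :: 'q
  show eq: "v\<^sub>M r = \<infinity> \<longleftrightarrow> r = 0" for r
    using le_matrix_filtration_iff[of \<infinity> v\<^sub>D "\<iota> r"] iota_simps(7)[of r]
    by (simp add: dvr_filtration_eq_infinity_iff[OF dvr unif] vec_eq_iff)
  show "\<exists>k::int. v\<^sub>M r = ereal (of_int k)" if "r \<noteq> 0"
  proof -
    obtain i j where ij: "v\<^sub>M r = v\<^sub>D (\<iota> r $ i $ j)" using matrix_filtration_attained by blast
    then have "\<iota> r $ i $ j \<noteq> 0" using eq[of r] that dvr_filtration_zero[OF dvr unif] by auto
    then show ?thesis unfolding ij by (rule dvr_filtration_integral[OF dvr unif])
  qed
  show "min (v\<^sub>M r) (v\<^sub>M s) \<le> v\<^sub>M (r - s)"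
  proof (subst le_matrix_filtration_iff, intro allI)
    fix i j
    have "min (v\<^sub>M r) (v\<^sub>M s) \<le> min (v\<^sub>D (\<iota> r $ i $ j)) (v\<^sub>D (\<iota> s $ i $ j))"
      using le_matrix_filtration_iff[of "v\<^sub>M r" v\<^sub>D "\<iota> r"] le_matrix_filtration_iff[of "v\<^sub>M s" v\<^sub>D "\<iota> s"]
      by (intro min.mono) auto
    also have "\<dots> \<le> v\<^sub>D (\<iota> (r - s) $ i $ j)"
      using dvr_filtration_diff[OF dvr unif] by (simp add: iota_simps)
    finally show "min (v\<^sub>M r) (v\<^sub>M s) \<le> v\<^sub>D (\<iota> (r - s) $ i $ j)" .
  qed
  show "v\<^sub>M r + v\<^sub>M s \<le> v\<^sub>M (r * s)" by (rule v_M_mult)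
  show "0 \<le> v\<^sub>M 1"
    unfolding v_M_nonneg_iff using D_closed(1,2)[OF dvr unif]
    by (simp add: iota_simps matrices_over_def mat_def)
  show "filt_complete v\<^sub>M {r. 0 \<le> v\<^sub>M r}" by (rule v_M_complete)
qed (use assms v_M_unit_of_value in blast)+

end

section \<open>Specialisation to matrices over a complete discrete valuation ring\<close>

theorem theoremC:
  fixes D :: "'f::division_ring set"
    and \<pi> :: "'f"
    and \<iota> :: "'q::ring_1 \<Rightarrow> 'f ^ 'n ^ 'n"
    and \<sigma> \<delta> :: "'q \<Rightarrow> 'q"
    and v\<^sub>F :: "'f \<Rightarrow> ereal" and v\<^sub>Q :: "'q \<Rightarrow> ereal" and \<O> :: "'q set"
    and OPoly OSeries QPoly :: "(nat \<Rightarrow> 'q) ring"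
    and \<pi>\<^sub>Q :: "nat \<Rightarrow> 'q" and S :: "(nat \<Rightarrow> 'q) set"
  defines "v\<^sub>F \<equiv> dvr_filtration D \<pi>"
    and "v\<^sub>Q \<equiv> (\<lambda>q. matrix_filtration v\<^sub>F (\<iota> q))"
    and "\<O> \<equiv> \<iota> -` matrices_over D"
  defines "OPoly \<equiv> skew_poly_ring \<O> \<sigma> \<delta>"
    and "OSeries \<equiv> skew_power_series_ring \<O> v\<^sub>Q \<sigma> \<delta>"
    and "QPoly \<equiv> skew_poly_ring (UNIV :: 'q set) \<sigma> \<delta>"
  defines "\<pi>\<^sub>Q \<equiv> const_series (inv_into UNIV \<iota> (mat \<pi>))"
  defines "S \<equiv> (if jacobson_radical (subring_of_type D) = {0} then {\<one>\<^bsub>OSeries\<^esub>}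
                 else {\<pi>\<^sub>Q [^]\<^bsub>OSeries\<^esub> k | k::nat. True})"
  assumes "discrete_valuation_ring D"
    and "uniformiser D \<pi>"
    and "filt_complete v\<^sub>F D"
    and "simple_ring (ring_of_type_algebra :: 'q ring)"
    and "two_sided_artinian (ring_of_type_algebra :: 'q ring)"
    and "\<iota> \<in> ring_iso (ring_of_type_algebra :: 'q ring) (matrix_ring :: ('f ^ 'n ^ 'n) ring)"
    and "skew_derivation \<sigma> \<delta>"
    and "filt_compatible v\<^sub>Q \<sigma> \<delta>"
  shows "(\<forall>I. ideal I OSeries \<and> I \<noteq> {\<zero>\<^bsub>OSeries\<^esub>} \<longrightarrow>
            I \<inter> carrier OPoly \<noteq> {\<zero>\<^bsub>OSeries\<^esub>}) \<and>
         (simple_ring QPoly \<longrightarrow>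
            (\<forall>T. localised_tensor_ring (ring_of_type_algebra :: 'q ring) OSeries
                   \<O> (\<lambda>r. r) const_series S T \<longrightarrow> simple_ring T))"
proof -
  note dvr = \<open>discrete_valuation_ring D\<close> and unif = \<open>uniformiser D \<pi>\<close>
  note ctx = dvr unif \<open>filt_complete v\<^sub>F D\<close>[unfolded v\<^sub>F_def]
    \<open>\<iota> \<in> ring_iso ring_of_type_algebra matrix_ring\<close>
  interpret Q: complete_filtered_skew_ring v\<^sub>Q \<sigma> \<delta>
    using complete_filtered_skew_ring_v_M[OF ctx] \<open>skew_derivation \<sigma> \<delta>\<close>
      \<open>filt_compatible v\<^sub>Q \<sigma> \<delta>\<close> unfolding v\<^sub>Q_def v\<^sub>F_def .
  \<comment> \<open>The abstract results take a ball as coefficient ring, the theorem the preimage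
    of the integral matrices.\<close>
  have O_eq: "Q.fball 0 = \<O>"
    unfolding Q.fball_0 \<O>_def vimage_def
    using v_M_nonneg_iff[OF ctx] by (simp add: v\<^sub>Q_def v\<^sub>F_def)
  note ring_simps = Q.series_ring_simps[unfolded O_eq, folded OSeries_def]
  have "I \<inter> carrier OPoly \<noteq> {\<zero>\<^bsub>OSeries\<^esub>}" if I: "ideal I OSeries" "I \<noteq> {\<zero>\<^bsub>OSeries\<^esub>}" for I
  proof -
    obtain w where w: "w \<in> I" "w \<noteq> \<zero>\<^bsub>OSeries\<^esub>" "finite {i. w i \<noteq> 0}"
      using Q.ideal_meets_polynomials[unfolded O_eq, folded OSeries_def, OF I] by blast
    have "w \<in> carrier OSeries" using ideal.Icarr[OF I(1) w(1)] .
    then have "w \<in> carrier OPoly"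
      using w(3) by (simp add: ring_simps OPoly_def skew_poly_ring_def)
    with w show ?thesis by blast
  qed
  moreover have "simple_ring T"
    if "simple_ring QPoly"
      and T: "localised_tensor_ring (ring_of_type_algebra :: 'q ring) OSeries
        \<O> (\<lambda>r. r) const_series S T" for T
  proof (rule Q.simple_localised_tensor_ring[unfolded O_eq, folded OSeries_def, OF _ T])
    show "simple_ring (skew_poly_ring UNIV \<sigma> \<delta>)" using that by (simp add: QPoly_def)
    have one: "(1 :: 'q) \<noteq> 0"
      using \<open>simple_ring (ring_of_type_algebra :: 'q ring)\<close>
      by (simp add: simple_ring_def ring_of_type_algebra_simps)
    have const_nz: "const_series a \<noteq> \<zero>\<^bsub>OSeries\<^esub>" if "a \<noteq> (0 :: 'q)" for a
      using that by (metis const_series_def ring_simps(4))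
    \<comment> \<open>This keeps the localisation from collapsing. With zero radical it is
      \<open>1 \<noteq> 0\<close>; otherwise the powers of \<open>\<pi>\<^sub>Q\<close> are the
      constants \<open>?p ^ k\<close>, nonzero because \<open>?p\<close> is right
      invertible.\<close>
    show "\<zero>\<^bsub>OSeries\<^esub> \<notin> S"
    proof (cases "jacobson_radical (subring_of_type D) = {0}")
      case True
      then show ?thesis using const_nz[OF one] by (simp add: S_def ring_simps)
    next
      case False
      let ?p = "inv_into UNIV \<iota> (mat \<pi>)" and ?p' = "inv_into UNIV \<iota> (mat (inverse \<pi>))"
      have "0 \<in> D" using D_closed(1)[OF dvr unif] .
      then have "\<pi> \<noteq> 0" using False unif unfolding uniformiser_def by auto
      then have "\<iota> (?p * ?p') = \<iota> 1"
        by (simp add: iota_simps[OF ctx] mat_mult_mat)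
      then have inv: "?p * ?p' = 1" using iota_simps(1)[OF ctx] by (metis bij_is_inj injD)
      have p_nz: "?p ^ k \<noteq> 0" for k
      proof (induction k)
        case (Suc k)
        have "?p ^ Suc k * ?p' = ?p ^ k" by (simp only: power_Suc2 mult.assoc inv mult_1_right)
        then show ?case using Suc by (metis mult_zero_left)
      qed (simp add: one)
      have "\<pi>\<^sub>Q [^]\<^bsub>OSeries\<^esub> k = const_series (?p ^ k)" for k :: nat
      proof (induction k)
        case 0
        show ?case by (simp add: nat_pow_def ring_simps)
      next
        case (Suc k)
        have "\<pi>\<^sub>Q [^]\<^bsub>OSeries\<^esub> Suc k = const_series (?p ^ k) \<otimes>\<^bsub>OSeries\<^esub> \<pi>\<^sub>Q"
          using Suc by (simp add: nat_pow_def)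
        also have "\<dots> = const_series (?p ^ Suc k)"
          unfolding \<pi>\<^sub>Q_def Q.const_series_mult[unfolded O_eq, folded OSeries_def] power_Suc2
          by (auto simp: const_series_def)
        finally show ?case .
      qed
      then have "\<pi>\<^sub>Q [^]\<^bsub>OSeries\<^esub> k \<noteq> \<zero>\<^bsub>OSeries\<^esub>" for k :: nat
        using const_nz[OF p_nz[of k]] by simp
      then show ?thesis unfolding S_def if_not_P[OF False] by force
    qed
  qed
  ultimately show ?thesis by blast
qed

end
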